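(* For each $n$, let $d=d(n)$ with $d\to\infty$ as $n\to\infty$, let $\mathcal P$ be a binary graph property on graphs with vertex set $[d]$, let $G_0\in\mathcal G_0(\mathcal P)$, and let $\mathcal C$ be a null-alternative divider with null base $G_0$ (all these objects and $\theta\ge 0$ may depend on $n$). Suppose that $|\mathcal C|\to\infty$ as $n\to\infty$. If (for all sufficiently large $n$) $$\theta \le \frac12\sqrt{\frac{\log N(\mathcal C, d_{G_0}, \log\log|\mathcal C|)}{n}}\ \wedge\ \operatorname{atanh}\Big(\frac{e^{-2}}{\operatorname{maxdeg}(G_0)+1}\Big),$$ then $\liminf_{n\to\infty}R_n(\mathcal P,\theta)=1$.
   Context: Graphs are finite and simple; $\mathcal G_d$ is the set of all graphs with vertex set $[d]=\{1,\dots,d\}$; $\operatorname{maxdeg}(G)$ is the maximum degree; $a\wedge b=\min(a,b)$. A binary graph property is a map $\mathcal P:\mathcal G_d\to\{0,1\}$; $\mathcal G_i(\mathcal P)=\{G\in\mathcal G_d:\mathcal P(G)=i\}$, $i=0,1$. Model: for $\theta\ge0$ and a graph $G$ on $[d]$, $\mathbb P_{\theta,G}(\boldsymbol X=\boldsymbol x)=Z_{\theta,G}^{-1}\exp\big(\theta\sum_{(u,v)\in E(G)}x_ux_v\big)$ for $\boldsymbol x\in\{\pm1\}^d$, with $Z_{\theta,G}$ the normalizing constant; $\mathbb P^{\otimes n}_{\theta,G}$ is the law of $n$ i.i.d. observations. Minimax risk: $R_n(\mathcal P,\theta)=\inf_\psi\big[\sup_{G\in\mathcal G_0(\mathcal P)}\mathbb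 P^{\otimes n}_{\theta,G}(\psi=1)+\sup_{G\in\mathcal G_1(\mathcal P)}\mathbb P^{\otimes n}_{\theta,G}(\psi=0)\big]$, the infimum being over all measurable $\{0,1\}$-valued tests $\psi$ of the $n$ observations. Edge geodesic pre-distance: for a graph $G$ and two edges (unordered pairs of vertices) $e,e'$, not necessarily in $G$, $d_G(e,e')=\min_{u\in e,v\in e'}d_G(u,v)$, where $d_G(u,v)$ is the number of edges in a shortest path from $u$ to $v$ in $G$ ($\infty$ if no path exists). Packing number: for a collection $\mathcal C$ of edges on the vertex set of $G$, an $r$-packing of $\mathcal C$ is a subset $S\subseteq\mathcal C$ such that each pair of (distinct) edges $e,e'\in S$ satisfies $d_G(e,e')\ge r$; $N(\mathcal C,d_G,r)$ is the maximum cardinality of an $r$-packing. Divider: for $G_0=([d],E_0)\in\mathcal G_0(\mathcal P)$, an edge set $\mathcal C=\{e_1,\dots,e_m\}$ is a null-alternative divider with null base $G_0$ if for every $e\in\mathcal C$ the graph $([d],E_0\cup\{e\})$ belongs to $\mathcal G_1(\mathcal P)$. *)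

theory Defs
  imports "HOL-Probability.Probability" "HOL-Probability.Product_PMF" "HOL-Library.Ramsey"
begin

text \<open>
  A simple graph on the vertex set \<open>{1..d}\<close> is identified with its edge set, a set of
  two-element subsets of \<open>{1..d}\<close>.
\<close>

definition graphs :: "nat \<Rightarrow> nat set set set" where
  "graphs d = Pow (nsets {1..d} 2)"

definition max_degree :: "nat \<Rightarrow> nat set set \<Rightarrow> nat" where
  "max_degree d E = Max ((\<lambda>v. card {e \<in> E. v \<in> e}) ` {1..d})"

text \<open>
  A binary graph property is a predicate \<open>P\<close>, of which only the values on \<^term>\<open>graphs d\<close> matter;
  \<open>False\<close> and \<open>True\<close> stand for the values 0 and 1.
\<close>

definition property_class :: "nat \<Rightarrow> (nat set set \<Rightarrow> bool) \<Rightarrow> bool \<Rightarrow> nat set set set" where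
  "property_class d P b = {G \<in> graphs d. P G = b}"

text \<open>
  Spin vectors are functions that are \<open>undefined\<close> outside \<open>{1..d}\<close>. For an edge \<open>e = {u, v}\<close> the
  product over \<open>e\<close> is \<open>x u * x v\<close>, so every unordered edge is counted once.
\<close>

definition spins :: "nat \<Rightarrow> (nat \<Rightarrow> real) set" where
  "spins d = {1..d} \<rightarrow>\<^sub>E {-1, 1}"

definition ising_weight :: "real \<Rightarrow> nat set set \<Rightarrow> (nat \<Rightarrow> real) \<Rightarrow> real" where
  "ising_weight \<theta> E x = exp (\<theta> * (\<Sum>e\<in>E. \<Prod>u\<in>e. x u))"

definition ising_Z :: "nat \<Rightarrow> real \<Rightarrow> nat set set \<Rightarrow> real" where
  "ising_Z d \<theta> E = (\<Sum>x\<in>spins d. ising_weight \<theta> E x)"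

definition ising_pmf :: "nat \<Rightarrow> real \<Rightarrow> nat set set \<Rightarrow> (nat \<Rightarrow> real) pmf" where
  "ising_pmf d \<theta> E =
     embed_pmf (\<lambda>x. if x \<in> spins d then ising_weight \<theta> E x / ising_Z d \<theta> E else 0)"

lemma finite_spins [simp]: "finite (spins d)"
  by (simp add: spins_def finite_PiE)

lemma spins_nonempty [simp]: "spins d \<noteq> {}"
  by (simp add: spins_def PiE_eq_empty_iff)

lemma ising_Z_pos: "ising_Z d \<theta> E > 0"
  unfolding ising_Z_def ising_weight_def by (intro sum_pos) auto

lemma pmf_ising:
  "pmf (ising_pmf d \<theta> E) x = (if x \<in> spins d then ising_weight \<theta> E x / ising_Z d \<theta> E else 0)"
  unfolding ising_pmf_def
proof (rule pmf_embed_pmf)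
  let ?f = "\<lambda>x. if x \<in> spins d then ising_weight \<theta> E x / ising_Z d \<theta> E else 0"
  show nonneg: "0 \<le> ?f x" for x
    using ising_Z_pos[of d \<theta> E] by (simp add: ising_weight_def)
  have "(\<integral>\<^sup>+x. ennreal (?f x) \<partial>count_space UNIV) = (\<Sum>x\<in>spins d. ennreal (?f x))"
    by (intro nn_integral_count_space') auto
  also have "\<dots> = ennreal (\<Sum>x\<in>spins d. ?f x)"
    by (intro sum_ennreal nonneg)
  also have "(\<Sum>x\<in>spins d. ?f x) = ising_Z d \<theta> E / ising_Z d \<theta> E"
    by (simp add: ising_Z_def flip: sum_divide_distrib)
  also have "\<dots> = 1"
    using ising_Z_pos[of d \<theta> E] by simp
  finally show "(\<integral>\<^sup>+x. ennreal (?f x) \<partial>count_space UNIV) = 1"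
    by simp
qed

definition ising_sample :: "nat \<Rightarrow> nat \<Rightarrow> real \<Rightarrow> nat set set \<Rightarrow> (nat \<Rightarrow> nat \<Rightarrow> real) pmf" where
  "ising_sample n d \<theta> E = Pi_pmf {..<n} undefined (\<lambda>_. ising_pmf d \<theta> E)"

text \<open>
  The sample space is finite, so every test is measurable and the infimum ranges over all functions.
  Values in \<^typ>\<open>ennreal\<close> make the supremum over an empty class of graphs equal to 0.
\<close>

definition minimax_risk :: "nat \<Rightarrow> nat \<Rightarrow> (nat set set \<Rightarrow> bool) \<Rightarrow> real \<Rightarrow> ennreal" where
  "minimax_risk n d P \<theta> =
     (INF \<psi> :: (nat \<Rightarrow> nat \<Rightarrow> real) \<Rightarrow> bool.
        (SUP G\<in>property_class d P False. emeasure (measure_pmf (ising_sample n d \<theta> G)) {X. \<psi> X}) +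
        (SUP G\<in>property_class d P True. emeasure (measure_pmf (ising_sample n d \<theta> G)) {X. \<not> \<psi> X}))"

definition is_path :: "'a set set \<Rightarrow> 'a \<Rightarrow> 'a \<Rightarrow> 'a list \<Rightarrow> bool" where
  "is_path E u v p \<longleftrightarrow>
     p \<noteq> [] \<and> hd p = u \<and> last p = v \<and> distinct p \<and> successively (\<lambda>a b. {a, b} \<in> E) p"

text \<open>The infimum over the empty set of paths is \<open>\<infinity>\<close>.\<close>

definition vertex_dist :: "'a set set \<Rightarrow> 'a \<Rightarrow> 'a \<Rightarrow> enat" where
  "vertex_dist E u v = (INF p\<in>{p. is_path E u v p}. enat (length p - 1))"

definition edge_dist :: "'a set set \<Rightarrow> 'a set \<Rightarrow> 'a set \<Rightarrow> enat" where
  "edge_dist E e e' = (INF u\<in>e. INF v\<in>e'. vertex_dist E u v)"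

definition is_packing :: "'a set set \<Rightarrow> 'a set set \<Rightarrow> real \<Rightarrow> 'a set set \<Rightarrow> bool" where
  "is_packing E C r S \<longleftrightarrow>
     S \<subseteq> C \<and> (\<forall>e\<in>S. \<forall>e'\<in>S. e \<noteq> e' \<longrightarrow> ereal r \<le> ereal_of_enat (edge_dist E e e'))"

definition packing_number :: "'a set set \<Rightarrow> 'a set set \<Rightarrow> real \<Rightarrow> nat" where
  "packing_number E C r = Max (card ` {S. is_packing E C r S})"

definition null_alternative_divider ::
    "nat \<Rightarrow> (nat set set \<Rightarrow> bool) \<Rightarrow> nat set set \<Rightarrow> nat set set \<Rightarrow> bool" where
  "null_alternative_divider d P E0 C \<longleftrightarrow>
     E0 \<in> property_class d P False \<and> C \<subseteq> nsets {1..d} 2 \<and>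
     (\<forall>e\<in>C. E0 \<union> {e} \<in> property_class d P True)"

end

theory Submission
  imports Defs "HOL-Real_Asymp.Real_Asymp"
begin

text \<open>
  The minimax risk is at least the error of testing the null base \<open>E\<^sub>0\<close> against the uniform mixture
  of the graphs \<open>E\<^sub>0 \<union> {e}\<close>, where \<open>e\<close> runs over a set \<open>S\<close> of edges of the divider. By
  \<open>mixture_second_moment_bound\<close> that error is at least \<open>1 - sqrt \<chi>\<^sup>2\<close>, with \<open>\<chi>\<^sup>2\<close> the chi-square distance of
  the mixture from the null, so it suffices to choose \<open>S\<close> such that \<open>\<chi>\<^sup>2\<close> tends to zero.

  Write \<open>t = tanh \<theta>\<close> and let \<open>x\<^sub>e\<close> be the product of the two spins of \<open>e\<close>. Adding \<open>e\<close> to \<open>E\<^sub>0\<close>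
  multiplies the density of one observation by \<open>(1 + t x\<^sub>e) / (1 + t E x\<^sub>e)\<close>. Hence \<open>1 + \<chi>\<^sup>2\<close> is at most
  the average over pairs \<open>e, e'\<close> in \<open>S\<close> of \<open>exp (n \<theta>\<^sup>2 \<kappa>)\<close>, where \<open>\<kappa> \<ge> 0\<close> is any upper bound on
  the covariance of \<open>x\<^sub>e\<close> and \<open>x\<^sub>e\<^sub>'\<close> under \<open>E\<^sub>0\<close> (\<open>expectation_sample_ratio_le\<close>, \<open>minimax_risk_ge\<close>).

  The covariances come from the high-temperature expansion, which writes a correlation as a quotient
  of sums of \<open>t ^ card F\<close> over subgraphs \<open>F\<close> with a prescribed set of odd-degree vertices. Switching
  a piece of the symmetric difference of two such subgraphs from one to the other proves the inequality of Lebowitz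
  (\<open>lebowitz_inequality\<close>), which bounds the covariance of two disjoint edges by products of two-point
  functions between them. Deleting an edge at an odd vertex bounds a correlation by \<open>t\<close> times the sum
  over the neighbours (\<open>subgraph_sum_le_neighbours\<close>). Iterated, this shows that two-point functions
  decay like \<open>exp (- 2)\<close> to the power of the distance, because \<open>t\<close> times the maximum degree is at most
  \<open>exp (- 2)\<close>, and also that they are at most \<open>2 * t\<close> for distinct vertices.

  The choice of \<open>S\<close> depends on the packing number \<open>N\<close>, which may stay bounded. If \<open>N\<close> exceeds the sample
  size, \<open>S\<close> is a maximum packing and the exponential decay over its separation makes the
  covariances negligible. Otherwise \<open>\<theta>\<close> tends to zero, so all covariances of distinct edges do
  too, and \<open>S\<close> is the whole divider (\<open>minimax_risk_ge_chi_square_bound\<close>).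
\<close>

section \<open>Sums over subgraphs with prescribed odd vertices\<close>

text \<open>
  \<open>odd_vertices\<close> is the boundary map over the two-element field: it turns symmetric differences
  of edge sets into symmetric differences of vertex sets.
\<close>
definition odd_vertices :: "'a set set \<Rightarrow> 'a set" where
  "odd_vertices F = {v. odd (card {e \<in> F. v \<in> e})}"

text \<open>
  Up to a common factor, \<open>subgraph_sum t E A\<close> is the unnormalized Ising correlation of the
  spins in \<open>A\<close> at \<open>t = tanh \<theta>\<close>; this makes correlations accessible to combinatorial arguments.
\<close>
definition subgraph_sum :: "real \<Rightarrow> 'a set set \<Rightarrow> 'a set \<Rightarrow> real" where
  "subgraph_sum t E A = (\<Sum>F | F \<subseteq> E \<and> odd_vertices F = A. t ^ card F)"

lemma odd_card_sym_diff:
  assumes "finite A" "finite B"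
  shows "odd (card (sym_diff A B)) \<longleftrightarrow> odd (card A) \<noteq> odd (card B)"
proof -
  have "card A = card (A - B) + card (A \<inter> B)" "card B = card (B - A) + card (A \<inter> B)"
    using card_Int_Diff[of A B] card_Int_Diff[of B A] assms by (auto simp: Int_commute)
  moreover have "card (sym_diff A B) = card (A - B) + card (B - A)"
    using assms by (intro card_Un_disjoint) auto
  ultimately show ?thesis
    by presburger
qed

lemma odd_vertices_empty [simp]: "odd_vertices {} = {}"
  by (simp add: odd_vertices_def)

lemma odd_vertices_single [simp]: "odd_vertices {e} = e"
proof -
  have "{e' \<in> {e}. v \<in> e'} = (if v \<in> e then {e} else {})" for v
    by auto
  then show ?thesis
    by (auto simp: odd_vertices_def)
qed

lemma odd_vertices_sym_diff:
  assumes "finite F" "finite G"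
  shows "odd_vertices (sym_diff F G) = sym_diff (odd_vertices F) (odd_vertices G)"
proof -
  have "{e \<in> sym_diff F G. v \<in> e} = sym_diff {e \<in> F. v \<in> e} {e \<in> G. v \<in> e}" for v
    by auto
  then show ?thesis
    using assms by (auto simp: odd_vertices_def odd_card_sym_diff)
qed

lemma odd_vertices_insert:
  assumes "finite F" "e \<notin> F"
  shows "odd_vertices (insert e F) = sym_diff e (odd_vertices F)"
  using odd_vertices_sym_diff[of "{e}" F] assms by (simp add: insert_Diff_if)

lemma odd_vertices_remove:
  assumes "finite F" "e \<in> F"
  shows "odd_vertices (F - {e}) = sym_diff (odd_vertices F) e"
proof -
  have "sym_diff F {e} = F - {e}"
    using assms by auto
  then show ?thesis
    using odd_vertices_sym_diff[of F "{e}"] assms by simp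
qed

lemma odd_vertex_has_edge:
  assumes "u \<in> odd_vertices F"
  obtains e where "e \<in> F" "u \<in> e"
proof -
  have "{e \<in> F. u \<in> e} \<noteq> {}"
    using assms unfolding odd_vertices_def by (metis card.empty even_zero mem_Collect_eq)
  then show ?thesis
    using that by blast
qed

text \<open>
  This is the handshake lemma for one connected component: leaving an odd vertex and walking along
  unused edges, one can only get stuck at another odd vertex. The induction takes one step of that
  walk; deleting the used edge moves the oddness from \<open>u\<close> to the other end of the edge.
\<close>
lemma odd_vertex_paired:
  assumes "finite D" "\<And>e. e \<in> D \<Longrightarrow> card e = 2" "u \<in> odd_vertices D"
  shows "\<exists>F y. F \<subseteq> D \<and> y \<in> odd_vertices D \<and> y \<noteq> u \<and> odd_vertices F = {u, y}"
  using assms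
proof (induction "card D" arbitrary: D u)
  case 0
  then show ?case by simp
next
  case (Suc k)
  from \<open>u \<in> odd_vertices D\<close> obtain e where e: "e \<in> D" "u \<in> e"
    by (rule odd_vertex_has_edge)
  with Suc.prems(2) obtain x y where "e = {x, y}" "x \<noteq> y"
    by (meson card_2_iff)
  with e(2) obtain a where a: "e = {u, a}" "a \<noteq> u"
    by auto
  show ?case
  proof (cases "a \<in> odd_vertices D")
    case True
    then show ?thesis
      using e a by (intro exI[of _ "{e}"] exI[of _ a]) auto
  next
    case False
    let ?D = "D - {e}"
    have odd: "odd_vertices ?D = insert a (odd_vertices D - {u})"
      unfolding odd_vertices_remove[OF Suc.prems(1) e(1)] unfolding a(1)
      using a(2) False Suc.prems(3) by blast
    moreover have "k = card ?D"
      using Suc.hyps(2) Suc.prems(1) e(1) by simp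
    moreover have "finite ?D" "\<And>e'. e' \<in> ?D \<Longrightarrow> card e' = 2"
      using Suc.prems by blast+
    ultimately have "\<exists>F y. F \<subseteq> ?D \<and> y \<in> odd_vertices ?D \<and> y \<noteq> a \<and> odd_vertices F = {a, y}"
      by (intro Suc.hyps(1)) blast+
    then obtain F y where F: "F \<subseteq> ?D" "y \<in> odd_vertices ?D" "y \<noteq> a" "odd_vertices F = {a, y}"
      by blast
    have "finite F" "e \<notin> F"
      using F(1) Suc.prems(1) by (auto intro: finite_subset)
    then have "odd_vertices (insert e F) = sym_diff {u, a} {a, y}"
      using F(4) a(1) by (simp add: odd_vertices_insert)
    also have "\<dots> = {u, y}"
      using F(2,3) odd a(2) by auto
    finally show ?thesis
      using F odd e(1) by (intro exI[of _ "insert e F"] exI[of _ y]) auto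
  qed
qed

lemma subgraph_sum_nonneg: "0 \<le> t \<Longrightarrow> 0 \<le> subgraph_sum t E A"
  by (simp add: subgraph_sum_def sum_nonneg)

lemma subgraph_sum_empty_pos:
  assumes "finite E" "0 \<le> t"
  shows "0 < subgraph_sum t E {}"
proof -
  have "(\<Sum>F\<in>{{} :: 'a set set}. t ^ card F) \<le> subgraph_sum t E {}"
    unfolding subgraph_sum_def using assms by (intro sum_mono2) auto
  then show ?thesis by simp
qed

text \<open>
  Moving the part \<open>F\<close> of the symmetric difference from each of the two edge sets to the other does
  not change their multiset union, so the joint weight of the pair survives a switch.
\<close>
lemma card_add_switch:
  assumes "finite A" "finite B" "F \<subseteq> sym_diff A B"
  shows "card (sym_diff A F) + card (sym_diff B F) = card A + card B"
proof -
  have fin: "finite (sym_diff A F)" "finite (sym_diff B F)"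
    using assms finite_subset[OF assms(3)] by auto
  have "card (sym_diff A F) + card (sym_diff B F) =
      card (sym_diff A F \<union> sym_diff B F) + card (sym_diff A F \<inter> sym_diff B F)"
    using fin by (rule card_Un_Int)
  also have "sym_diff A F \<union> sym_diff B F = A \<union> B"
    using assms(3) by auto
  also have "sym_diff A F \<inter> sym_diff B F = A \<inter> B"
    using assms(3) by auto
  also have "card (A \<union> B) + card (A \<inter> B) = card A + card B"
    using card_Un_Int[OF assms(1,2)] by (rule sym)
  finally show ?thesis .
qed

lemma subgraph_sum_mult:
  assumes "finite E"
  shows "subgraph_sum t E A * subgraph_sum t E B =
    (\<Sum>(F, G)\<in>{F. F \<subseteq> E \<and> odd_vertices F = A} \<times> {G. G \<subseteq> E \<and> odd_vertices G = B}.
       t ^ (card F + card G))"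
  unfolding subgraph_sum_def by (simp add: sum_product sum.cartesian_product power_add)

lemma sum_union_le:
  fixes f :: "'a \<Rightarrow> real"
  assumes "finite A" "finite B" "\<And>x. x \<in> A \<inter> B \<Longrightarrow> 0 \<le> f x"
  shows "sum f (A \<union> B) \<le> sum f A + sum f B"
  using assms sum_nonneg[of "A \<inter> B" f] by (simp add: sum_Un)

text \<open>
  A pair of subgraphs with odd vertices \<open>{u, v, w, z}\<close> and \<open>{}\<close> has a symmetric difference \<open>D\<close>
  whose odd vertices are \<open>{u, v, w, z}\<close>. Inside \<open>D\<close> the vertex \<open>u\<close> is paired with one of \<open>v\<close>,
  \<open>w\<close>, \<open>z\<close>, say \<open>y\<close>, by a subgraph with odd vertices \<open>{u, y}\<close>, and switching that subgraph turns
  the pair into one that the right-hand side counts.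
\<close>
lemma lebowitz_inequality:
  assumes E: "finite E" "\<And>e. e \<in> E \<Longrightarrow> card e = 2" and t: "0 \<le> t"
    and dist: "distinct [u, v, w, z]"
  shows "subgraph_sum t E {u, v, w, z} * subgraph_sum t E {} \<le>
    subgraph_sum t E {w, z} * subgraph_sum t E {u, v} +
    subgraph_sum t E {v, z} * subgraph_sum t E {u, w} +
    subgraph_sum t E {v, w} * subgraph_sum t E {u, z}"
proof -
  define Q where "Q A B = {F. F \<subseteq> E \<and> odd_vertices F = A} \<times> {G. G \<subseteq> E \<and> odd_vertices G = B}"
    for A B :: "'a set"
  define wt where "wt = (\<lambda>(F :: 'a set set, G :: 'a set set). t ^ (card F + card G))"
  have prod: "subgraph_sum t E A * subgraph_sum t E B = sum wt (Q A B)" for A B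
    unfolding Q_def wt_def using E(1) by (rule subgraph_sum_mult)
  have finQ: "finite (Q A B)" for A B
    unfolding Q_def using E(1) by simp
  have wt_nonneg: "0 \<le> wt p" for p
    using t by (simp add: wt_def split: prod.split)
  have finE: "finite F" if "F \<subseteq> E" for F
    using that E(1) by (rule finite_subset)
  (* The switched subgraph is a function of the symmetric difference alone. Switching preserves the
  symmetric difference, so it is an involution and in particular injective. *)
  define K where "K D = (SOME F. F \<subseteq> D \<and> (\<exists>y\<in>{v, w, z}. odd_vertices F = {u, y}))" for D
  define sw where "sw = (\<lambda>(F, G). (sym_diff F (K (sym_diff F G)), sym_diff G (K (sym_diff F G))))"
  have K: "K (sym_diff F G) \<subseteq> sym_diff F G \<and>
      (\<exists>y\<in>{v, w, z}. odd_vertices (K (sym_diff F G)) = {u, y})"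
    if FG: "(F, G) \<in> Q {u, v, w, z} {}" for F G
  proof -
    let ?D = "sym_diff F G"
    have sub: "F \<subseteq> E" "G \<subseteq> E" and odd: "odd_vertices F = {u, v, w, z}" "odd_vertices G = {}"
      using FG by (auto simp: Q_def)
    have "odd_vertices ?D = {u, v, w, z}"
      using odd_vertices_sym_diff[OF finE[OF sub(1)] finE[OF sub(2)]] odd by simp
    moreover have "finite ?D"
      using finE sub by auto
    ultimately have "\<exists>F. F \<subseteq> ?D \<and> (\<exists>y\<in>{v, w, z}. odd_vertices F = {u, y})"
      using odd_vertex_paired[of ?D u] E(2) sub by blast
    then show ?thesis
      unfolding K_def by (rule someI_ex)
  qed
  have inv: "sw (sw p) = p" for p
  proof (cases p)
    case (Pair F G)
    have "sym_diff (sym_diff F X) (sym_diff G X) = sym_diff F G"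
      "sym_diff (sym_diff F X) X = F" for F G X :: "'a set set"
      by blast+
    then show ?thesis
      by (simp add: sw_def Pair)
  qed
  have wt_sw: "wt (sw p) = wt p" if "p \<in> Q {u, v, w, z} {}" for p
  proof (cases p)
    case (Pair F G)
    then show ?thesis
      using that K[of F G] card_add_switch[OF finE finE, of F G "K (sym_diff F G)"]
      by (simp add: sw_def wt_def Q_def)
  qed
  have image: "sw ` Q {u, v, w, z} {} \<subseteq> Q {w, z} {u, v} \<union> Q {v, z} {u, w} \<union> Q {v, w} {u, z}"
  proof
    fix p assume "p \<in> sw ` Q {u, v, w, z} {}"
    then obtain F G where FG: "(F, G) \<in> Q {u, v, w, z} {}" and p: "p = sw (F, G)"
      by auto
    let ?K = "K (sym_diff F G)"
    obtain y where y: "y \<in> {v, w, z}" "odd_vertices ?K = {u, y}"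
      using K[OF FG] by blast
    have sub: "F \<subseteq> E" "G \<subseteq> E" "?K \<subseteq> E" and odd: "odd_vertices F = {u, v, w, z}" "odd_vertices G = {}"
      using FG K[OF FG] by (auto simp: Q_def)
    have "odd_vertices (sym_diff F ?K) = sym_diff {u, v, w, z} {u, y}"
      "odd_vertices (sym_diff G ?K) = {u, y}"
      using odd_vertices_sym_diff[OF finE[OF sub(1)] finE[OF sub(3)]]
        odd_vertices_sym_diff[OF finE[OF sub(2)] finE[OF sub(3)]] odd y by simp_all
    moreover have "sym_diff {u, v, w, z} {u, y} = {v, w, z} - {y}"
    proof -
      have "sym_diff (insert u S) {u, y} = S - {y}" if "u \<notin> S" "y \<in> S" for S
        using that by blast
      from this[OF _ y(1)] show ?thesis
        using dist by simp
    qed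
    moreover have "sym_diff F ?K \<subseteq> E" "sym_diff G ?K \<subseteq> E"
      using sub by blast+
    ultimately have "p \<in> Q ({v, w, z} - {y}) {u, y}"
      unfolding p sw_def Q_def by simp
    moreover have "{v, w, z} - {v} = {w, z}" "{v, w, z} - {w} = {v, z}" "{v, w, z} - {z} = {v, w}"
      using dist by (simp_all add: insert_Diff_if, fast+)
    ultimately show "p \<in> Q {w, z} {u, v} \<union> Q {v, z} {u, w} \<union> Q {v, w} {u, z}"
      using y(1) by (elim insertE) simp_all
  qed
  have "subgraph_sum t E {u, v, w, z} * subgraph_sum t E {} = sum (wt \<circ> sw) (Q {u, v, w, z} {})"
    unfolding prod comp_def using wt_sw by (intro sum.cong) auto
  also have "\<dots> = sum wt (sw ` Q {u, v, w, z} {})"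
    using inv by (subst sum.reindex) (auto intro: inj_on_inverseI[where g = sw])
  also have "\<dots> \<le> sum wt (Q {w, z} {u, v} \<union> Q {v, z} {u, w} \<union> Q {v, w} {u, z})"
    using finQ image wt_nonneg by (intro sum_mono2) auto
  also have "\<dots> \<le> sum wt (Q {w, z} {u, v} \<union> Q {v, z} {u, w}) + sum wt (Q {v, w} {u, z})"
    using finQ wt_nonneg by (intro sum_union_le) auto
  also have "sum wt (Q {w, z} {u, v} \<union> Q {v, z} {u, w}) \<le>
      sum wt (Q {w, z} {u, v}) + sum wt (Q {v, z} {u, w})"
    using finQ wt_nonneg by (intro sum_union_le) auto
  finally show ?thesis
    unfolding prod by simp
qed

text \<open>
  An odd vertex \<open>u\<close> has at least one edge in the subgraph, and deleting that edge costs a factor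
  \<open>t\<close> and moves the oddness along it. The inequality only overcounts the choice of the edge and
  the subgraphs that no longer contain it.
\<close>
lemma subgraph_sum_le_neighbours:
  assumes E: "finite E" and t: "0 \<le> t" and u: "u \<in> A"
  shows "subgraph_sum t E A \<le> t * (\<Sum>e | e \<in> E \<and> u \<in> e. subgraph_sum t E (sym_diff A e))"
proof -
  let ?Fs = "\<lambda>e. {F. F \<subseteq> E \<and> odd_vertices F = A \<and> e \<in> F}"
  have finE: "finite F" if "F \<subseteq> E" for F
    using that E(1) by (rule finite_subset)
  have "subgraph_sum t E A \<le>
      (\<Sum>F | F \<subseteq> E \<and> odd_vertices F = A. \<Sum>e | e \<in> E \<and> u \<in> e. if e \<in> F then t ^ card F else 0)"
    unfolding subgraph_sum_def
  proof (intro sum_mono)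
    fix F assume F: "F \<in> {F. F \<subseteq> E \<and> odd_vertices F = A}"
    then obtain e where e: "e \<in> F" "u \<in> e"
      using odd_vertex_has_edge[of u F] u by auto
    then have "t ^ card F = (if e \<in> F then t ^ card F else 0)"
      by simp
    also have "\<dots> \<le> (\<Sum>e | e \<in> E \<and> u \<in> e. if e \<in> F then t ^ card F else 0)"
      using E t e F
      by (intro member_le_sum[where f = "\<lambda>e. if e \<in> F then t ^ card F else 0"]) auto
    finally show "t ^ card F \<le> (\<Sum>e | e \<in> E \<and> u \<in> e. if e \<in> F then t ^ card F else 0)" .
  qed
  also have "\<dots> = (\<Sum>e | e \<in> E \<and> u \<in> e. \<Sum>F\<in>?Fs e. t ^ card F)"
    using E by (subst sum.swap) (simp_all add: sum.inter_filter [symmetric] conj_ac)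
  also have "\<dots> \<le> (\<Sum>e | e \<in> E \<and> u \<in> e. t * subgraph_sum t E (sym_diff A e))"
  proof (intro sum_mono)
    fix e assume "e \<in> {e. e \<in> E \<and> u \<in> e}"
    have remove: "F - {e} \<subseteq> E \<and> odd_vertices (F - {e}) = sym_diff A e" if "F \<in> ?Fs e" for F
    proof -
      have F: "F \<subseteq> E" "odd_vertices F = A" "e \<in> F"
        using that by blast+
      have "odd_vertices (F - {e}) = sym_diff A e"
        using odd_vertices_remove[OF finE[OF F(1)] F(3)] unfolding F(2) .
      then show ?thesis
        using F(1) by blast
    qed
    have inj: "inj_on (\<lambda>F. F - {e}) (?Fs e)"
    proof (rule inj_onI)
      fix F G assume "F \<in> ?Fs e" "G \<in> ?Fs e" "F - {e} = G - {e}"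
      then show "F = G"
        by (metis (mono_tags, lifting) insert_Diff mem_Collect_eq)
    qed
    have "t ^ card F = t * t ^ card (F - {e})" if "F \<in> ?Fs e" for F
      using card_Suc_Diff1[of F e] finE[of F] that by (metis (mono_tags, lifting) mem_Collect_eq power_Suc)
    then have "(\<Sum>F\<in>?Fs e. t ^ card F) = (\<Sum>F\<in>?Fs e. t * t ^ card (F - {e}))"
      by (intro sum.cong refl) blast
    also have "\<dots> = (\<Sum>F\<in>(\<lambda>F. F - {e}) ` ?Fs e. t * t ^ card F)"
      unfolding sum.reindex[OF inj] comp_def ..
    also have "\<dots> \<le> (\<Sum>F | F \<subseteq> E \<and> odd_vertices F = sym_diff A e. t * t ^ card F)"
    proof (intro sum_mono2)
      show "(\<lambda>F. F - {e}) ` ?Fs e \<subseteq> {F. F \<subseteq> E \<and> odd_vertices F = sym_diff A e}"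
        using remove by blast
    qed (use E t in auto)
    finally show "(\<Sum>F\<in>?Fs e. t ^ card F) \<le> t * subgraph_sum t E (sym_diff A e)"
      by (simp add: subgraph_sum_def sum_distrib_left)
  qed
  finally show ?thesis
    by (simp add: sum_distrib_left)
qed

section \<open>The high-temperature expansion of the Ising model\<close>

lemma spins_cases: "x \<in> spins d \<Longrightarrow> v \<in> {1..d} \<Longrightarrow> x v = - 1 \<or> x v = 1"
  by (auto simp: spins_def dest!: PiE_mem)

lemma spin_prod_square:
  assumes "x \<in> spins d" "A \<subseteq> {1..d}"
  shows "(\<Prod>u\<in>A. x u) * (\<Prod>u\<in>A. x u) = 1"
  unfolding prod.distrib [symmetric]
  using spins_cases[OF assms(1)] subsetD[OF assms(2)] by (intro prod.neutral ballI) fastforce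

lemma spin_prod_cases:
  assumes "x \<in> spins d" "A \<subseteq> {1..d}"
  shows "(\<Prod>u\<in>A. x u) = - 1 \<or> (\<Prod>u\<in>A. x u) = 1"
  using spin_prod_square[OF assms] by (metis square_eq_1_iff)

lemma spin_prod_sym_diff:
  assumes x: "x \<in> spins d" and sub: "A \<subseteq> {1..d}" "B \<subseteq> {1..d}"
  shows "(\<Prod>u\<in>sym_diff A B. x u) = (\<Prod>u\<in>A. x u) * (\<Prod>u\<in>B. x u)"
proof -
  have fin: "finite A" "finite B"
    using sub finite_subset by blast+
  have "(\<Prod>u\<in>A. x u) = (\<Prod>u\<in>A - B. x u) * (\<Prod>u\<in>A \<inter> B. x u)"
    "(\<Prod>u\<in>B. x u) = (\<Prod>u\<in>B - A. x u) * (\<Prod>u\<in>A \<inter> B. x u)"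
    using prod.Int_Diff[OF fin(1), of x B] prod.Int_Diff[OF fin(2), of x A]
    by (simp_all add: mult.commute Int_commute)
  moreover have "(\<Prod>u\<in>A \<inter> B. x u) * (\<Prod>u\<in>A \<inter> B. x u) = 1"
    using sub by (intro spin_prod_square[OF x]) blast
  moreover have "(\<Prod>u\<in>sym_diff A B. x u) = (\<Prod>u\<in>A - B. x u) * (\<Prod>u\<in>B - A. x u)"
    using fin by (intro prod.union_disjoint) auto
  ultimately show ?thesis
    by (simp add: mult_ac)
qed

lemma odd_vertices_subset: "odd_vertices F \<subseteq> \<Union>F"
  by (rule subsetI, elim odd_vertex_has_edge UnionI)

lemma nsets_2_finite:
  fixes E :: "nat set set"
  assumes "E \<subseteq> nsets {1..d} 2"
  shows "finite E"
  using assms by (rule finite_subset) (simp add: finite_imp_finite_nsets)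

lemma nsets_2_edge:
  assumes "E \<subseteq> nsets V 2" "e \<in> E"
  shows "e \<subseteq> V" "card e = 2"
  using subsetD[OF assms] by (simp_all add: nsets_def)

text \<open>
  A spin that occurs an even number of times in the product over the edges squares away.
\<close>
lemma edge_prod_eq_vertex_prod:
  assumes x: "x \<in> spins d" and F: "F \<subseteq> nsets {1..d} 2"
  shows "(\<Prod>e\<in>F. \<Prod>u\<in>e. x u) = (\<Prod>u\<in>odd_vertices F. x u)"
  using nsets_2_finite[OF F] F
proof (induction F rule: finite_induct)
  case empty
  then show ?case by simp
next
  case (insert e F)
  have "e \<subseteq> {1..d}" "odd_vertices F \<subseteq> {1..d}"
    using nsets_2_edge(1)[OF insert.prems] odd_vertices_subset[of F] by blast+
  then have "(\<Prod>u\<in>odd_vertices (insert e F). x u) = (\<Prod>u\<in>e. x u) * (\<Prod>u\<in>odd_vertices F. x u)"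
    unfolding odd_vertices_insert[OF insert.hyps] by (intro spin_prod_sym_diff[OF x])
  moreover have "(\<Prod>e\<in>F. \<Prod>u\<in>e. x u) = (\<Prod>u\<in>odd_vertices F. x u)"
    using insert.prems by (intro insert.IH) blast
  ultimately show ?case
    using insert.hyps by simp
qed

lemma sum_spins_prod:
  assumes "A \<subseteq> {1..d}"
  shows "(\<Sum>x\<in>spins d. \<Prod>u\<in>A. x u) = (if A = {} then 2 ^ d else 0)"
proof -
  define f :: "nat \<Rightarrow> real \<Rightarrow> real" where "f u y = (if u \<in> A then y else 1)" for u y
  have "(\<Sum>x\<in>spins d. \<Prod>u\<in>A. x u) = (\<Sum>x\<in>spins d. \<Prod>u\<in>{1..d}. f u (x u))"
  proof (intro sum.cong refl)
    fix x
    have "{1..d} \<inter> A = A"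
      using assms by blast
    then show "(\<Prod>u\<in>A. x u) = (\<Prod>u\<in>{1..d}. f u (x u))"
      using prod.inter_restrict[of "{1..d}" x A] by (simp add: f_def)
  qed
  also have "\<dots> = (\<Prod>u\<in>{1..d}. \<Sum>y\<in>{- 1, 1}. f u y)"
    unfolding spins_def by (rule prod_sum_PiE [symmetric]) auto
  also have "\<dots> = (\<Prod>u\<in>{1..d}. if u \<in> A then 0 else 2)"
    by (intro prod.cong refl) (simp add: f_def)
  also have "\<dots> = (if A = {} then 2 ^ d else 0)"
  proof (cases "A = {}")
    case False
    then obtain a where a: "a \<in> A" "a \<in> {1..d}"
      using assms by blast
    have "(\<Prod>u\<in>{1..d}. if u \<in> A then 0 else (2 :: real)) = 0"
      by (rule prod_zero) (use a in auto)
    then show ?thesis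
      using False by simp
  qed simp
  finally show ?thesis .
qed

definition spin_corr :: "nat \<Rightarrow> real \<Rightarrow> nat set set \<Rightarrow> nat set \<Rightarrow> real" where
  "spin_corr d \<theta> E A = measure_pmf.expectation (ising_pmf d \<theta> E) (\<lambda>x. \<Prod>u\<in>A. x u)"

lemma set_ising_pmf: "set_pmf (ising_pmf d \<theta> E) = spins d"
  using ising_Z_pos[of d \<theta> E] by (auto simp: set_pmf_eq pmf_ising ising_weight_def)

lemma expectation_ising:
  fixes f :: "_ \<Rightarrow> real"
  shows "measure_pmf.expectation (ising_pmf d \<theta> E) f =
    (\<Sum>x\<in>spins d. ising_weight \<theta> E x * f x) / ising_Z d \<theta> E"
proof -
  have "measure_pmf.expectation (ising_pmf d \<theta> E) f =
      (\<Sum>x\<in>spins d. f x * pmf (ising_pmf d \<theta> E) x)"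
    by (rule integral_measure_pmf_real) (simp_all add: set_ising_pmf)
  also have "\<dots> = (\<Sum>x\<in>spins d. ising_weight \<theta> E x * f x / ising_Z d \<theta> E)"
    by (intro sum.cong refl) (simp add: pmf_ising)
  finally show ?thesis
    by (simp add: sum_divide_distrib)
qed

text \<open>
  An exponential of a sign is affine in it. This linearizes each edge factor of the model, both in
  the expansion below and in the likelihood ratio of adding one edge.
\<close>
lemma exp_spin:
  fixes \<theta> s :: real
  assumes "s = - 1 \<or> s = 1"
  shows "exp (\<theta> * s) = cosh \<theta> * (1 + tanh \<theta> * s)"
proof -
  have "cosh \<theta> * (1 + tanh \<theta> * s) = cosh \<theta> + sinh \<theta> * s"
    by (simp add: tanh_def algebra_simps)
  also have "\<dots> = exp (\<theta> * s)"
    using assms by (auto simp: cosh_def sinh_def field_simps)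
  finally show ?thesis ..
qed

text \<open>
  Expanding the product of the linearized edge factors gives one term for each subgraph \<open>F\<close>.
  Summing over the spins kills every term whose odd vertices do not cancel the factor of \<open>A\<close>.
\<close>
lemma high_temperature_expansion:
  assumes E: "E \<subseteq> nsets {1..d} 2" and A: "A \<subseteq> {1..d}"
  shows "(\<Sum>x\<in>spins d. ising_weight \<theta> E x * (\<Prod>u\<in>A. x u)) =
    2 ^ d * cosh \<theta> ^ card E * subgraph_sum (tanh \<theta>) E A"
proof -
  let ?t = "tanh \<theta>"
  note finE = nsets_2_finite[OF E]
  have oddE: "odd_vertices F \<subseteq> {1..d}" if "F \<subseteq> E" for F
    using odd_vertices_subset[of F] nsets_2_edge(1)[OF E] that by blast
  have weight: "ising_weight \<theta> E x = cosh \<theta> ^ card E * (\<Sum>F\<in>Pow E. ?t ^ card F * (\<Prod>u\<in>odd_vertices F. x u))"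
    if x: "x \<in> spins d" for x
  proof -
    have "ising_weight \<theta> E x = (\<Prod>e\<in>E. exp (\<theta> * (\<Prod>u\<in>e. x u)))"
      unfolding ising_weight_def sum_distrib_left by (rule exp_sum[OF finE])
    also have "\<dots> = (\<Prod>e\<in>E. cosh \<theta> * (?t * (\<Prod>u\<in>e. x u) + 1))"
      using spin_prod_cases[OF x nsets_2_edge(1)[OF E]]
      by (intro prod.cong refl) (simp add: exp_spin add.commute)
    also have "\<dots> = cosh \<theta> ^ card E * (\<Prod>e\<in>E. ?t * (\<Prod>u\<in>e. x u) + 1)"
      by (simp add: prod.distrib)
    also have "(\<Prod>e\<in>E. ?t * (\<Prod>u\<in>e. x u) + 1) = (\<Sum>F\<in>Pow E. ?t ^ card F * (\<Prod>e\<in>F. \<Prod>u\<in>e. x u))"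
      by (simp add: prod_add[OF finE] prod.distrib)
    also have "\<dots> = (\<Sum>F\<in>Pow E. ?t ^ card F * (\<Prod>u\<in>odd_vertices F. x u))"
      using edge_prod_eq_vertex_prod[OF x] E by (intro sum.cong refl) auto
    finally show ?thesis .
  qed
  have "(\<Sum>x\<in>spins d. ising_weight \<theta> E x * (\<Prod>u\<in>A. x u)) =
      (\<Sum>x\<in>spins d. \<Sum>F\<in>Pow E. cosh \<theta> ^ card E * ?t ^ card F * (\<Prod>u\<in>sym_diff (odd_vertices F) A. x u))"
  proof (intro sum.cong refl)
    fix x assume x: "x \<in> spins d"
    have "(\<Sum>F\<in>Pow E. cosh \<theta> ^ card E * ?t ^ card F * (\<Prod>u\<in>sym_diff (odd_vertices F) A. x u)) =
        (\<Sum>F\<in>Pow E. cosh \<theta> ^ card E * ?t ^ card F * ((\<Prod>u\<in>odd_vertices F. x u) * (\<Prod>u\<in>A. x u)))"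
      using spin_prod_sym_diff[OF x oddE A] by (intro sum.cong refl) auto
    also have "\<dots> = ising_weight \<theta> E x * (\<Prod>u\<in>A. x u)"
      unfolding weight[OF x] by (simp add: sum_distrib_left sum_distrib_right mult_ac)
    finally show "ising_weight \<theta> E x * (\<Prod>u\<in>A. x u) =
        (\<Sum>F\<in>Pow E. cosh \<theta> ^ card E * ?t ^ card F * (\<Prod>u\<in>sym_diff (odd_vertices F) A. x u))" ..
  qed
  also have "\<dots> = (\<Sum>F\<in>Pow E. cosh \<theta> ^ card E * ?t ^ card F *
      (\<Sum>x\<in>spins d. \<Prod>u\<in>sym_diff (odd_vertices F) A. x u))"
    by (subst sum.swap) (simp add: sum_distrib_left)
  also have "\<dots> = (\<Sum>F\<in>Pow E. if odd_vertices F = A then 2 ^ d * cosh \<theta> ^ card E * ?t ^ card F else 0)"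
  proof (intro sum.cong refl)
    fix F assume F: "F \<in> Pow E"
    have sub: "sym_diff (odd_vertices F) A \<subseteq> {1..d}"
      using oddE[of F] F A by blast
    have "sym_diff (odd_vertices F) A = {} \<longleftrightarrow> odd_vertices F = A"
      by blast
    then show "cosh \<theta> ^ card E * ?t ^ card F * (\<Sum>x\<in>spins d. \<Prod>u\<in>sym_diff (odd_vertices F) A. x u) =
        (if odd_vertices F = A then 2 ^ d * cosh \<theta> ^ card E * ?t ^ card F else 0)"
      unfolding sum_spins_prod[OF sub] by simp
  qed
  also have "\<dots> = (\<Sum>F\<in>{F \<in> Pow E. odd_vertices F = A}. 2 ^ d * cosh \<theta> ^ card E * ?t ^ card F)"
    using finE by (intro sum.inter_filter [symmetric]) simp
  also have "{F \<in> Pow E. odd_vertices F = A} = {F. F \<subseteq> E \<and> odd_vertices F = A}"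
    by (simp only: Pow_iff)
  finally show ?thesis
    by (simp add: subgraph_sum_def sum_distrib_left)
qed

lemma spin_corr_eq:
  assumes E: "E \<subseteq> nsets {1..d} 2" and A: "A \<subseteq> {1..d}"
  shows "spin_corr d \<theta> E A = subgraph_sum (tanh \<theta>) E A / subgraph_sum (tanh \<theta>) E {}"
proof -
  have "ising_Z d \<theta> E = 2 ^ d * cosh \<theta> ^ card E * subgraph_sum (tanh \<theta>) E {}"
    using high_temperature_expansion[OF E, of "{}" \<theta>] by (simp add: ising_Z_def)
  then show ?thesis
    unfolding spin_corr_def expectation_ising high_temperature_expansion[OF E A] by simp
qed

lemma spin_corr_le_1:
  assumes A: "A \<subseteq> {1..d}"
  shows "spin_corr d \<theta> E A \<le> 1"
proof -
  have "(\<Sum>x\<in>spins d. ising_weight \<theta> E x * (\<Prod>u\<in>A. x u)) \<le> ising_Z d \<theta> E"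
    unfolding ising_Z_def
  proof (intro sum_mono)
    fix x assume x: "x \<in> spins d"
    have "(\<Prod>u\<in>A. x u) \<le> 1"
      using spin_prod_cases[OF x A] by linarith
    then show "ising_weight \<theta> E x * (\<Prod>u\<in>A. x u) \<le> ising_weight \<theta> E x"
      by (simp add: ising_weight_def)
  qed
  then show ?thesis
    using ising_Z_pos[of d \<theta> E] by (simp add: spin_corr_def expectation_ising)
qed

section \<open>Bounds on correlations and edge covariances\<close>

lemma spin_corr_nonneg:
  assumes "E \<subseteq> nsets {1..d} 2" "A \<subseteq> {1..d}" "0 \<le> \<theta>"
  shows "0 \<le> spin_corr d \<theta> E A"
  using assms by (simp add: spin_corr_eq subgraph_sum_nonneg)

lemma spin_corr_empty [simp]: "spin_corr d \<theta> E {} = 1"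
  by (simp add: spin_corr_def)

lemma spin_corr_le_neighbours:
  assumes E: "E \<subseteq> nsets {1..d} 2" and A: "A \<subseteq> {1..d}" and \<theta>: "0 \<le> \<theta>" and u: "u \<in> A"
  shows "spin_corr d \<theta> E A \<le> tanh \<theta> * (\<Sum>e | e \<in> E \<and> u \<in> e. spin_corr d \<theta> E (sym_diff A e))"
proof -
  note fin = nsets_2_finite[OF E]
  let ?S = "subgraph_sum (tanh \<theta>) E"
  have t: "0 \<le> tanh \<theta>"
    using \<theta> by simp
  have "spin_corr d \<theta> E A = ?S A / ?S {}"
    by (rule spin_corr_eq[OF E A])
  also have "\<dots> \<le> tanh \<theta> * (\<Sum>e | e \<in> E \<and> u \<in> e. ?S (sym_diff A e)) / ?S {}"
    using subgraph_sum_le_neighbours[OF fin t u] subgraph_sum_empty_pos[OF fin t]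
    by (intro divide_right_mono) auto
  also have "\<dots> = tanh \<theta> * (\<Sum>e | e \<in> E \<and> u \<in> e. ?S (sym_diff A e) / ?S {})"
    by (simp flip: sum_divide_distrib)
  also have "(\<Sum>e | e \<in> E \<and> u \<in> e. ?S (sym_diff A e) / ?S {}) =
      (\<Sum>e | e \<in> E \<and> u \<in> e. spin_corr d \<theta> E (sym_diff A e))"
  proof (intro sum.cong refl)
    fix e assume "e \<in> {e. e \<in> E \<and> u \<in> e}"
    then have "sym_diff A e \<subseteq> {1..d}"
      using nsets_2_edge(1)[OF E, of e] A by blast
    then show "?S (sym_diff A e) / ?S {} = spin_corr d \<theta> E (sym_diff A e)"
      by (simp add: spin_corr_eq[OF E])
  qed
  finally show ?thesis .
qed

text \<open>
  The inequality of Lebowitz: the truncated four-point function is controlled by two-point functions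
  that link the pair \<open>u, v\<close> with the pair \<open>w, z\<close>.
\<close>
lemma spin_corr_lebowitz:
  assumes E: "E \<subseteq> nsets {1..d} 2" and \<theta>: "0 \<le> \<theta>"
    and vert: "{u, v, w, z} \<subseteq> {1..d}" and dist: "distinct [u, v, w, z]"
  shows "spin_corr d \<theta> E {u, v, w, z} - spin_corr d \<theta> E {u, v} * spin_corr d \<theta> E {w, z} \<le>
    spin_corr d \<theta> E {u, w} * spin_corr d \<theta> E {v, z} +
    spin_corr d \<theta> E {u, z} * spin_corr d \<theta> E {v, w}"
proof -
  note fin = nsets_2_finite[OF E]
  let ?S = "subgraph_sum (tanh \<theta>) E"
  have t: "0 \<le> tanh \<theta>"
    using \<theta> by simp
  have pos: "0 < ?S {}"
    by (rule subgraph_sum_empty_pos[OF fin t])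
  have "?S {u, v, w, z} * ?S {} \<le>
      ?S {w, z} * ?S {u, v} + ?S {v, z} * ?S {u, w} + ?S {v, w} * ?S {u, z}"
    by (rule lebowitz_inequality[OF fin _ t dist]) (rule nsets_2_edge(2)[OF E])
  then have "?S {u, v, w, z} * ?S {} / (?S {} * ?S {}) \<le>
      (?S {w, z} * ?S {u, v} + ?S {v, z} * ?S {u, w} + ?S {v, w} * ?S {u, z}) / (?S {} * ?S {})"
    using pos by (intro divide_right_mono) auto
  moreover have "spin_corr d \<theta> E A = ?S A / ?S {}" if "A \<subseteq> {u, v, w, z}" for A
    using that vert by (intro spin_corr_eq[OF E]) blast
  ultimately show ?thesis
    using pos by (simp add: add_divide_distrib mult.commute)
qed

lemma vertex_dist_self: "vertex_dist E u u = 0"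
proof -
  have "is_path E u u [u]"
    by (simp add: is_path_def)
  then have "vertex_dist E u u \<le> enat (length [u] - 1)"
    unfolding vertex_dist_def by (intro INF_lower) simp
  then show ?thesis
    by (simp flip: zero_enat_def)
qed

text \<open>
  Distances are defined by simple paths, so a path from \<open>w\<close> that already visits \<open>u\<close> is cut
  at \<open>u\<close> instead of being extended.
\<close>
lemma vertex_dist_step:
  assumes uw: "{u, w} \<in> E"
  shows "vertex_dist E u v \<le> eSuc (vertex_dist E w v)"
proof -
  have "vertex_dist E u v \<le> eSuc (enat (length p - 1))" if p: "is_path E w v p" for p
  proof -
    obtain q where q: "is_path E u v q" "length q \<le> Suc (length p)"
    proof (cases "u \<in> set p")
      case True
      then obtain xs ys where xs: "p = xs @ u # ys"
        by (auto dest: split_list)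
      have "is_path E u v (u # ys)"
        using p by (auto simp: is_path_def xs successively_append_iff)
      then show ?thesis
        using that[of "u # ys"] by (simp add: xs)
    next
      case False
      have "is_path E u v (u # p)"
        using p False uw by (cases p) (auto simp: is_path_def)
      then show ?thesis
        using that[of "u # p"] by simp
    qed
    have "vertex_dist E u v \<le> enat (length q - 1)"
      unfolding vertex_dist_def using q(1) by (intro INF_lower) simp
    also have "length q - 1 \<le> Suc (length p - 1)"
      using q(2) p by (auto simp: is_path_def)
    finally show ?thesis
      by (simp add: eSuc_enat)
  qed
  then have "vertex_dist E u v \<le> (INF p\<in>{p. is_path E w v p}. eSuc (enat (length p - 1)))"
    by (intro INF_greatest) simp
  also have "\<dots> \<le> eSuc (vertex_dist E w v)"
  proof (cases "{p. is_path E w v p} = {}")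
    case True
    then show ?thesis
      by (simp add: vertex_dist_def top_enat_def)
  next
    case False
    define A where "A = (\<lambda>p. enat (length p - 1)) ` {p. is_path E w v p}"
    obtain p' where "is_path E w v p'"
      using False by blast
    then have "enat (length p' - 1) \<in> A"
      unfolding A_def by blast
    then have "Inf A \<in> A"
      by (rule wellorder_InfI)
    then obtain p where "is_path E w v p" "vertex_dist E w v = enat (length p - 1)"
      unfolding vertex_dist_def A_def by auto
    then show ?thesis
      by (metis (mono_tags) INF_lower mem_Collect_eq)
  qed
  finally show ?thesis .
qed

lemma card_edges_le_max_degree:
  assumes "v \<in> {1..d}"
  shows "card {e \<in> E. v \<in> e} \<le> max_degree d E"
  unfolding max_degree_def using assms by (intro Max_ge) auto

lemma nsets_2_other_end:
  assumes "e \<in> nsets V 2" "u \<in> e"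
  obtains w where "e = {u, w}" "w \<noteq> u" "w \<in> V"
  using assms by (elim nsets2_E) blast

lemma sum_edges_le:
  assumes u: "u \<in> {1..d}" and c: "0 \<le> c"
    and le: "\<And>e. e \<in> E \<Longrightarrow> u \<in> e \<Longrightarrow> f e \<le> c"
  shows "(\<Sum>e | e \<in> E \<and> u \<in> e. f e) \<le> real (max_degree d E) * c"
proof -
  have "(\<Sum>e | e \<in> E \<and> u \<in> e. f e) \<le> (\<Sum>e | e \<in> E \<and> u \<in> e. c)"
    using le by (intro sum_mono) blast
  also have "\<dots> \<le> real (max_degree d E) * c"
    using card_edges_le_max_degree[OF u, of E] c by (simp add: mult_right_mono)
  finally show ?thesis .
qed

text \<open>
  Each application of the neighbour inequality costs a factor \<open>tanh \<theta>\<close> for each of at most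
  \<open>max_degree\<close> edges and brings \<open>u\<close> at most one step closer to \<open>v\<close>. The symmetric difference of
  singletons makes the case \<open>u = v\<close>, where the correlation is 1, an instance of the same formula.
\<close>
lemma spin_corr_exp_decay:
  assumes E: "E \<subseteq> nsets {1..d} 2" and \<theta>: "0 \<le> \<theta>" and uv: "u \<in> {1..d}" "v \<in> {1..d}"
    and k: "enat k \<le> vertex_dist E u v"
  shows "spin_corr d \<theta> E (sym_diff {u} {v}) \<le> (tanh \<theta> * max_degree d E) ^ k"
  using uv(1) k
proof (induction k arbitrary: u)
  case 0
  then show ?case
    using uv(2) by (simp, intro spin_corr_le_1) auto
next
  case (Suc k)
  let ?q = "tanh \<theta> * max_degree d E"
  have q: "0 \<le> ?q"
    using \<theta> by simp
  have "u \<noteq> v"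
    using Suc.prems(2) by (auto simp: vertex_dist_self zero_enat_def)
  have "spin_corr d \<theta> E (sym_diff {u} {v}) \<le>
      tanh \<theta> * (\<Sum>e | e \<in> E \<and> u \<in> e. spin_corr d \<theta> E (sym_diff (sym_diff {u} {v}) e))"
    using \<open>u \<noteq> v\<close> Suc.prems(1) uv(2) by (intro spin_corr_le_neighbours[OF E _ \<theta>]) auto
  also have "\<dots> \<le> tanh \<theta> * (real (max_degree d E) * ?q ^ k)"
  proof (intro mult_left_mono sum_edges_le[OF Suc.prems(1)])
    fix e assume e: "e \<in> E" "u \<in> e"
    then obtain w where w: "e = {u, w}" "w \<noteq> u" "w \<in> {1..d}"
      using nsets_2_other_end[of e "{1..d}" u] E by blast
    have "enat (Suc k) \<le> eSuc (vertex_dist E w v)"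
      using Suc.prems(2) vertex_dist_step[of u w E v] e(1) w(1) by (auto intro: order_trans)
    then have "enat k \<le> vertex_dist E w v"
      by (simp flip: eSuc_enat)
    then have "spin_corr d \<theta> E (sym_diff {w} {v}) \<le> ?q ^ k"
      by (rule Suc.IH[OF w(3)])
    moreover have "sym_diff (sym_diff {u} {v}) e = sym_diff {w} {v}"
      using w(2) \<open>u \<noteq> v\<close> unfolding w(1) by blast
    ultimately show "spin_corr d \<theta> E (sym_diff (sym_diff {u} {v}) e) \<le> ?q ^ k"
      by simp
  qed (use q \<theta> in simp_all)
  finally show ?case
    by (simp add: mult_ac)
qed

text \<open>
  In the neighbour inequality at most one edge at \<open>u\<close> leads directly to \<open>v\<close>, which contributes
  \<open>tanh \<theta>\<close>; all other edges reproduce a correlation of the same kind, with total factor at most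
  \<open>1 / 2\<close>. So the geometric series \<open>tanh \<theta> * (1 + 1 / 2 + 1 / 4 + \<dots>)\<close> dominates. The iteration
  keeps the remainder explicit and lets it tend to zero.
\<close>
lemma spin_corr_pair_le:
  assumes E: "E \<subseteq> nsets {1..d} 2" and \<theta>: "0 \<le> \<theta>"
    and q: "tanh \<theta> * max_degree d E \<le> 1 / 2"
    and uv: "u \<in> {1..d}" "v \<in> {1..d}" "u \<noteq> v"
  shows "spin_corr d \<theta> E {u, v} \<le> 2 * tanh \<theta>"
proof -
  let ?t = "tanh \<theta>" and ?q = "tanh \<theta> * max_degree d E"
  have t: "0 \<le> ?t" and q0: "0 \<le> ?q"
    using \<theta> by simp_all
  have iter: "spin_corr d \<theta> E {u, v} \<le> 2 * ?t + ?q ^ k" if "u \<in> {1..d}" "u \<noteq> v" for u k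
    using that
  proof (induction k arbitrary: u)
    case 0
    then have "spin_corr d \<theta> E {u, v} \<le> 1"
      using uv(2) by (intro spin_corr_le_1) simp
    then show ?case
      unfolding power_0 using t by linarith
  next
    case (Suc k)
    let ?c = "2 * ?t + ?q ^ k"
    let ?f = "\<lambda>e. spin_corr d \<theta> E (sym_diff {u, v} e)"
    have c: "0 \<le> ?c"
      using t q0 by simp
    have "?f e \<le> (if e = {u, v} then 1 else 0) + ?c" if e: "e \<in> E" "u \<in> e" for e
    proof (cases "e = {u, v}")
      case False
      obtain w where w: "e = {u, w}" "w \<noteq> u" "w \<in> {1..d}"
        using nsets_2_other_end[of e "{1..d}" u] E e by blast
      have "sym_diff {u, v} e = {w, v}" "w \<noteq> v"
        using w False Suc.prems(2) by auto
      then show ?thesis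
        using Suc.IH[OF w(3)] False by simp
    qed (use c in simp)
    then have "(\<Sum>e | e \<in> E \<and> u \<in> e. ?f e) \<le> (\<Sum>e | e \<in> E \<and> u \<in> e. (if e = {u, v} then 1 else 0) + ?c)"
      by (intro sum_mono) blast
    also have "\<dots> \<le> 1 + (\<Sum>e | e \<in> E \<and> u \<in> e. ?c)"
      using nsets_2_finite[OF E] by (simp add: sum.distrib sum.delta)
    also have "(\<Sum>e | e \<in> E \<and> u \<in> e. ?c) \<le> real (max_degree d E) * ?c"
      using Suc.prems(1) c by (intro sum_edges_le) auto
    finally have sum_le: "(\<Sum>e | e \<in> E \<and> u \<in> e. ?f e) \<le> 1 + real (max_degree d E) * ?c"
      by simp
    have "spin_corr d \<theta> E {u, v} \<le> ?t * (\<Sum>e | e \<in> E \<and> u \<in> e. ?f e)"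
      using Suc.prems(1) uv(2) by (intro spin_corr_le_neighbours[OF E _ \<theta>]) auto
    also have "\<dots> \<le> ?t * (1 + real (max_degree d E) * ?c)"
      using sum_le t by (rule mult_left_mono)
    also have "\<dots> = ?t + 2 * ?t * ?q + ?q ^ Suc k"
      by (simp add: algebra_simps)
    also have "\<dots> \<le> 2 * ?t + ?q ^ Suc k"
      using mult_left_mono[OF q, of "2 * ?t"] t by simp
    finally show ?case .
  qed
  have "(\<lambda>k. 2 * ?t + ?q ^ k) \<longlonglongrightarrow> 2 * ?t + 0"
    using q q0 by (intro tendsto_intros LIMSEQ_realpow_zero) auto
  then have "spin_corr d \<theta> E {u, v} \<le> 2 * ?t + 0"
    using iter[OF uv(1,3)] by (intro LIMSEQ_le_const) auto
  then show ?thesis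
    by simp
qed

text \<open>
  Since spins square to 1, the product of \<open>x\<^sub>e\<close> and \<open>x\<^sub>e\<^sub>'\<close> is the spin product over the symmetric
  difference, and this is the covariance of the two edge variables.
\<close>
definition edge_cov :: "nat \<Rightarrow> real \<Rightarrow> nat set set \<Rightarrow> nat set \<Rightarrow> nat set \<Rightarrow> real" where
  "edge_cov d \<theta> E e e' =
     spin_corr d \<theta> E (sym_diff e e') - spin_corr d \<theta> E e * spin_corr d \<theta> E e'"

text \<open>
  Edges at positive distance are disjoint, so the inequality of Lebowitz applies, and each of its
  four two-point functions links an endpoint of \<open>e\<close> with one of \<open>e'\<close>.
\<close>
lemma edge_cov_le_far:
  assumes E: "E \<subseteq> nsets {1..d} 2" and \<theta>: "0 \<le> \<theta>"
    and e: "e \<in> nsets {1..d} 2" "e' \<in> nsets {1..d} 2"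
    and k: "enat k \<le> edge_dist E e e'" "0 < k"
  shows "edge_cov d \<theta> E e e' \<le> 2 * (tanh \<theta> * max_degree d E) ^ (2 * k)"
proof -
  let ?q = "tanh \<theta> * max_degree d E"
  have q: "0 \<le> ?q"
    using \<theta> by simp
  obtain u v where uv: "e = {u, v}" "u \<in> {1..d}" "v \<in> {1..d}" "u \<noteq> v"
    using e(1) by (elim nsets2_E)
  obtain w z where wz: "e' = {w, z}" "w \<in> {1..d}" "z \<in> {1..d}" "w \<noteq> z"
    using e(2) by (elim nsets2_E)
  have far: "enat k \<le> vertex_dist E a b" if "a \<in> e" "b \<in> e'" for a b
  proof -
    have "edge_dist E e e' \<le> vertex_dist E a b"
      unfolding edge_dist_def using that by (intro INF_lower2[OF that(1)] INF_lower)
    with k(1) show ?thesis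
      by (rule order_trans)
  qed
  have disj: "a \<noteq> b" if "a \<in> e" "b \<in> e'" for a b
    using far[OF that] k(2) by (auto simp: vertex_dist_self zero_enat_def)
  have corr: "spin_corr d \<theta> E {a, b} \<le> ?q ^ k" "0 \<le> spin_corr d \<theta> E {a, b}"
    if "a \<in> e" "b \<in> e'" for a b
  proof -
    have ab: "a \<in> {1..d}" "b \<in> {1..d}"
      using that uv wz by auto
    have "sym_diff {a} {b} = {a, b}"
      using disj[OF that] by blast
    then show "spin_corr d \<theta> E {a, b} \<le> ?q ^ k"
      using spin_corr_exp_decay[OF E \<theta> ab far[OF that]] by simp
    show "0 \<le> spin_corr d \<theta> E {a, b}"
      using ab by (intro spin_corr_nonneg[OF E _ \<theta>]) auto
  qed
  have dist: "distinct [u, v, w, z]"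
    using disj[of u w] disj[of u z] disj[of v w] disj[of v z] uv(1,4) wz(1,4) by simp
  then have "sym_diff e e' = {u, v, w, z}"
    unfolding uv(1) wz(1) by auto
  moreover have "{u, v, w, z} \<subseteq> {1..d}"
    using uv wz by simp
  ultimately have "edge_cov d \<theta> E e e' \<le>
      spin_corr d \<theta> E {u, w} * spin_corr d \<theta> E {v, z} +
      spin_corr d \<theta> E {u, z} * spin_corr d \<theta> E {v, w}"
    using spin_corr_lebowitz[OF E \<theta> _ dist] unfolding edge_cov_def by (simp add: uv(1) wz(1))
  also have "\<dots> \<le> ?q ^ k * ?q ^ k + ?q ^ k * ?q ^ k"
    using q uv(1) wz(1) by (intro add_mono mult_mono corr) auto
  also have "\<dots> = 2 * ?q ^ (2 * k)"
    by (simp only: mult_2 power_add)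
  finally show ?thesis .
qed

text \<open>
  A bound of order \<open>tanh \<theta>\<close> without any separation. It serves the regime in which \<open>\<theta>\<close> itself
  tends to zero. If the edges share a vertex, its spin cancels and the covariance is at most a single
  two-point function.
\<close>
lemma edge_cov_le_distinct:
  assumes E: "E \<subseteq> nsets {1..d} 2" and \<theta>: "0 \<le> \<theta>"
    and q: "tanh \<theta> * max_degree d E \<le> 1 / 2"
    and e: "e \<in> nsets {1..d} 2" "e' \<in> nsets {1..d} 2" "e \<noteq> e'"
  shows "edge_cov d \<theta> E e e' \<le> 4 * tanh \<theta>"
proof -
  have t: "0 \<le> tanh \<theta>"
    using \<theta> by simp
  have nonneg: "0 \<le> spin_corr d \<theta> E A" if "A \<subseteq> {1..d}" for A
    by (rule spin_corr_nonneg[OF E that \<theta>])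
  note pair = spin_corr_pair_le[OF E \<theta> q]
  show ?thesis
  proof (cases "e \<inter> e' = {}")
    case False
    then obtain u where u: "u \<in> e" "u \<in> e'"
      by blast
    obtain v where v: "e = {u, v}" "v \<noteq> u" "v \<in> {1..d}"
      using nsets_2_other_end[OF e(1) u(1)] .
    obtain w where w: "e' = {u, w}" "w \<noteq> u" "w \<in> {1..d}"
      using nsets_2_other_end[OF e(2) u(2)] .
    have "v \<noteq> w"
      using e(3) v(1) w(1) by blast
    have "sym_diff e e' = {v, w}"
      using v(2) w(2) \<open>v \<noteq> w\<close> unfolding v(1) w(1) by blast
    then have "edge_cov d \<theta> E e e' \<le> spin_corr d \<theta> E {v, w}"
      unfolding edge_cov_def using nonneg nsets_2_edge(1)[of "{e, e'}"] e by simp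
    also have "\<dots> \<le> 2 * tanh \<theta>"
      using v(3) w(3) \<open>v \<noteq> w\<close> by (rule pair)
    finally show ?thesis
      using t by linarith
  next
    case True
    obtain u v where uv: "e = {u, v}" "u \<in> {1..d}" "v \<in> {1..d}" "u \<noteq> v"
      using e(1) by (elim nsets2_E)
    obtain w z where wz: "e' = {w, z}" "w \<in> {1..d}" "z \<in> {1..d}" "w \<noteq> z"
      using e(2) by (elim nsets2_E)
    have dist: "distinct [u, v, w, z]"
      using True uv(1,4) wz(1,4) by auto
    then have "sym_diff e e' = {u, v, w, z}"
      unfolding uv(1) wz(1) by auto
    moreover have "{u, v, w, z} \<subseteq> {1..d}"
      using uv wz by simp
    ultimately have "edge_cov d \<theta> E e e' \<le>
        spin_corr d \<theta> E {u, w} * spin_corr d \<theta> E {v, z} +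
        spin_corr d \<theta> E {u, z} * spin_corr d \<theta> E {v, w}"
      using spin_corr_lebowitz[OF E \<theta> _ dist] unfolding edge_cov_def by (simp add: uv(1) wz(1))
    also have "\<dots> \<le> 2 * tanh \<theta> * 1 + 2 * tanh \<theta> * 1"
      using t uv wz dist by (intro add_mono mult_mono pair spin_corr_le_1 nonneg) auto
    finally show ?thesis
      by simp
  qed
qed

section \<open>Testing against a mixture of one-edge perturbations\<close>

text \<open>
  Averaged over \<open>S\<close>, the error sum is \<open>1 + E\<^sub>p ((M - 1) 1\<^sub>B)\<close> with \<open>M\<close> the mixture likelihood ratio and
  \<open>B\<close> the acceptance region, hence at least \<open>1 - E\<^sub>p \<bar>M - 1\<bar>\<close>. By Cauchy-Schwarz this is at least
  one minus the square root of the chi-square distance of the mixture from \<open>p\<close>, and some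
  \<open>s \<in> S\<close> does at least as badly as the average.
\<close>
lemma mixture_second_moment_bound:
  fixes p :: "'a pmf" and q :: "'b \<Rightarrow> 'a pmf" and L :: "'b \<Rightarrow> 'a \<Rightarrow> real" and b :: real
  assumes fin: "finite (set_pmf p)" and S: "finite S" "S \<noteq> {}"
    and L: "\<And>s X. s \<in> S \<Longrightarrow> pmf (q s) X = L s X * pmf p X"
    and moment: "(\<Sum>s\<in>S. \<Sum>s'\<in>S. measure_pmf.expectation p (\<lambda>X. L s X * L s' X)) \<le> (1 + b) * (card S)\<^sup>2"
  shows "\<exists>s\<in>S. 1 - sqrt b \<le> measure_pmf.prob p {X. \<psi> X} + measure_pmf.prob (q s) {X. \<not> \<psi> X}"
proof -
  let ?N = "real (card S)"
  let ?E = "measure_pmf.expectation p"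
  let ?B = "{X. \<not> \<psi> X}"
  define M where "M X = (\<Sum>s\<in>S. L s X) / ?N" for X
  have N: "0 < ?N"
    using S by (simp add: card_gt_0_iff)
  have int [simp]: "integrable (measure_pmf p) f" for f :: "'a \<Rightarrow> real"
    using fin by (rule integrable_measure_pmf_finite)
  have change: "measure_pmf.prob (q s) A = ?E (\<lambda>X. L s X * indicator A X)" if s: "s \<in> S" for s A
  proof -
    have sub: "set_pmf (q s) \<subseteq> set_pmf p"
      using L[OF s] by (auto simp: set_pmf_eq)
    have "measure_pmf.prob (q s) A = measure_pmf.expectation (q s) (indicator A)"
      by simp
    also have "\<dots> = (\<Sum>X\<in>set_pmf p. indicator A X * pmf (q s) X)"
      using sub by (intro integral_measure_pmf_real[OF fin]) blast
    also have "\<dots> = (\<Sum>X\<in>set_pmf p. (L s X * indicator A X) * pmf p X)"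
      by (intro sum.cong refl) (simp add: L[OF s])
    also have "\<dots> = ?E (\<lambda>X. L s X * indicator A X)"
      by (rule integral_measure_pmf_real[OF fin, symmetric])
    finally show ?thesis .
  qed
  have mix: "(\<Sum>s\<in>S. measure_pmf.prob (q s) A) = ?N * ?E (\<lambda>X. M X * indicator A X)" for A
  proof -
    have "(\<Sum>s\<in>S. measure_pmf.prob (q s) A) = ?E (\<lambda>X. \<Sum>s\<in>S. L s X * indicator A X)"
      by (simp add: change)
    also have "(\<lambda>X. \<Sum>s\<in>S. L s X * indicator A X) = (\<lambda>X. ?N * (M X * indicator A X))"
      using N by (simp add: M_def sum_distrib_right)
    finally show ?thesis
      by simp
  qed
  have EM: "?E M = 1"
    using mix[of UNIV] N by simp
  have "?N\<^sup>2 * ?E (\<lambda>X. (M X)\<^sup>2) = ?E (\<lambda>X. ?N\<^sup>2 * (M X)\<^sup>2)"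
    by simp
  also have "(\<lambda>X. ?N\<^sup>2 * (M X)\<^sup>2) = (\<lambda>X. \<Sum>s\<in>S. \<Sum>s'\<in>S. L s X * L s' X)"
    using N by (simp add: M_def power_divide sum_product power2_eq_square)
  also have "?E \<dots> = (\<Sum>s\<in>S. \<Sum>s'\<in>S. ?E (\<lambda>X. L s X * L s' X))"
    by simp
  also have "\<dots> \<le> ?N\<^sup>2 * (1 + b)"
    using moment by (simp add: mult.commute)
  finally have EM2: "?E (\<lambda>X. (M X)\<^sup>2) \<le> 1 + b"
    using N by simp
  have "0 \<le> measure_pmf.variance p (\<lambda>X. \<bar>M X - 1\<bar>)"
    by (rule measure_pmf.variance_positive)
  also have "\<dots> = ?E (\<lambda>X. (M X - 1)\<^sup>2) - (?E (\<lambda>X. \<bar>M X - 1\<bar>))\<^sup>2"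
    by (subst measure_pmf.variance_eq) simp_all
  also have "?E (\<lambda>X. (M X - 1)\<^sup>2) = ?E (\<lambda>X. (M X)\<^sup>2) - 1"
    by (simp add: power2_diff EM)
  finally have "(?E (\<lambda>X. \<bar>M X - 1\<bar>))\<^sup>2 \<le> b"
    using EM2 by simp
  then have L1: "?E (\<lambda>X. \<bar>M X - 1\<bar>) \<le> sqrt b"
    by (rule real_le_rsqrt)
  have "measure_pmf.prob p {X. \<psi> X} = 1 - ?E (indicator ?B)"
    using measure_pmf.prob_compl[of "{X. \<not> \<psi> X}" p] by (simp add: Compl_eq_Diff_UNIV [symmetric] Collect_neg_eq [symmetric])
  moreover have "?E (\<lambda>X. M X * indicator ?B X) - ?E (indicator ?B) = ?E (\<lambda>X. (M X - 1) * indicator ?B X)"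
    by (subst Bochner_Integration.integral_diff [symmetric]) (simp_all add: algebra_simps)
  moreover have "?E (\<lambda>X. - \<bar>M X - 1\<bar>) \<le> ?E (\<lambda>X. (M X - 1) * indicator ?B X)"
    by (intro integral_mono) (auto simp: indicator_def)
  ultimately have avg: "1 - sqrt b \<le> measure_pmf.prob p {X. \<psi> X} + ?E (\<lambda>X. M X * indicator ?B X)"
    using L1 by simp
  show ?thesis
  proof (rule ccontr)
    assume "\<not> ?thesis"
    then have "measure_pmf.prob (q s) ?B < ?E (\<lambda>X. M X * indicator ?B X)" if "s \<in> S" for s
      using avg that by force
    then have "(\<Sum>s\<in>S. measure_pmf.prob (q s) ?B) < (\<Sum>s\<in>S. ?E (\<lambda>X. M X * indicator ?B X))"
      using S by (intro sum_strict_mono)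
    then show False
      using mix[of ?B] by simp
  qed
qed

text \<open>
  The likelihood ratio, for one observation, of adding the edge \<open>e\<close> to \<open>E\<close>.
\<close>
definition edge_ratio :: "nat \<Rightarrow> real \<Rightarrow> nat set set \<Rightarrow> nat set \<Rightarrow> (nat \<Rightarrow> real) \<Rightarrow> real" where
  "edge_ratio d \<theta> E e x = (1 + tanh \<theta> * (\<Prod>u\<in>e. x u)) / (1 + tanh \<theta> * spin_corr d \<theta> E e)"

lemma spin_corr_sum:
  "(\<Sum>x\<in>spins d. ising_weight \<theta> E x * (\<Prod>u\<in>A. x u)) = spin_corr d \<theta> E A * ising_Z d \<theta> E"
  using ising_Z_pos[of d \<theta> E] by (simp add: spin_corr_def expectation_ising)

lemma pmf_ising_insert:
  assumes E: "E \<subseteq> nsets {1..d} 2" and e: "e \<subseteq> {1..d}" "e \<notin> E"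
  shows "pmf (ising_pmf d \<theta> (insert e E)) x = edge_ratio d \<theta> E e x * pmf (ising_pmf d \<theta> E) x"
proof -
  let ?t = "tanh \<theta>"
  have weight: "ising_weight \<theta> (insert e E) x = cosh \<theta> * (1 + ?t * (\<Prod>u\<in>e. x u)) * ising_weight \<theta> E x"
    if "x \<in> spins d" for x
  proof -
    have "ising_weight \<theta> (insert e E) x = exp (\<theta> * (\<Prod>u\<in>e. x u)) * ising_weight \<theta> E x"
      using nsets_2_finite[OF E] e(2) by (simp add: ising_weight_def distrib_left exp_add)
    then show ?thesis
      by (simp only: exp_spin[OF spin_prod_cases[OF that e(1)]])
  qed
  have "ising_Z d \<theta> (insert e E) =
      (\<Sum>x\<in>spins d. cosh \<theta> * (ising_weight \<theta> E x + ?t * (ising_weight \<theta> E x * (\<Prod>u\<in>e. x u))))"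
    unfolding ising_Z_def by (intro sum.cong refl) (simp add: weight algebra_simps)
  also have "\<dots> = cosh \<theta> * (ising_Z d \<theta> E + ?t * (spin_corr d \<theta> E e * ising_Z d \<theta> E))"
    by (simp add: sum_distrib_left [symmetric] sum.distrib spin_corr_sum ising_Z_def [symmetric])
  also have "\<dots> = cosh \<theta> * (1 + ?t * spin_corr d \<theta> E e) * ising_Z d \<theta> E"
    by (simp add: algebra_simps)
  finally have Z: "ising_Z d \<theta> (insert e E) = cosh \<theta> * (1 + ?t * spin_corr d \<theta> E e) * ising_Z d \<theta> E" .
  show ?thesis
    by (simp add: pmf_ising Z weight edge_ratio_def mult.assoc)
qed

lemma edge_ratio_nonneg:
  assumes E: "E \<subseteq> nsets {1..d} 2" and e: "e \<subseteq> {1..d}" and \<theta>: "0 \<le> \<theta>" and x: "x \<in> spins d"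
  shows "0 \<le> edge_ratio d \<theta> E e x"
proof -
  have "0 \<le> tanh \<theta> * spin_corr d \<theta> E e"
    using spin_corr_nonneg[OF E e \<theta>] \<theta> by simp
  moreover have "0 \<le> 1 + tanh \<theta> * (\<Prod>u\<in>e. x u)"
    using spin_prod_cases[OF x e] tanh_real_bounds[of \<theta>] by auto
  ultimately show ?thesis
    unfolding edge_ratio_def by (intro divide_nonneg_nonneg) linarith+
qed

text \<open>
  The product of the two numerators has as expectation the product of the two denominators plus
  \<open>tanh \<theta> ^ 2\<close> times the covariance. The denominators are at least 1 because correlations are
  nonnegative, so dividing by them only shrinks the nonnegative bound \<open>tanh \<theta> ^ 2 * \<kappa>\<close> on the
  second term.
\<close>
lemma expectation_edge_ratio:
  assumes E: "E \<subseteq> nsets {1..d} 2" and e: "e \<subseteq> {1..d}" "e' \<subseteq> {1..d}"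
    and \<theta>: "0 \<le> \<theta>" and \<kappa>: "0 \<le> \<kappa>" "edge_cov d \<theta> E e e' \<le> \<kappa>"
  shows "measure_pmf.expectation (ising_pmf d \<theta> E) (\<lambda>x. edge_ratio d \<theta> E e x * edge_ratio d \<theta> E e' x)
    \<le> 1 + (tanh \<theta>)\<^sup>2 * \<kappa>"
proof -
  let ?t = "tanh \<theta>"
  let ?m = "spin_corr d \<theta> E e" and ?m' = "spin_corr d \<theta> E e'" and ?c = "spin_corr d \<theta> E (sym_diff e e')"
  define D where "D = (1 + ?t * ?m) * (1 + ?t * ?m')"
  let ?Ex = "measure_pmf.expectation (ising_pmf d \<theta> E)"
  have int [simp]: "integrable (measure_pmf (ising_pmf d \<theta> E)) f" for f :: "(nat \<Rightarrow> real) \<Rightarrow> real"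
    by (rule integrable_measure_pmf_finite) (simp add: set_ising_pmf)
  have "1 * 1 \<le> (1 + ?t * ?m) * (1 + ?t * ?m')"
    using spin_corr_nonneg[OF E e(1) \<theta>] spin_corr_nonneg[OF E e(2) \<theta>] \<theta> by (intro mult_mono) auto
  then have D: "1 \<le> D"
    by (simp add: D_def)
  have "?Ex (\<lambda>x. edge_ratio d \<theta> E e x * edge_ratio d \<theta> E e' x) =
      ?Ex (\<lambda>x. (1 + ?t * (\<Prod>u\<in>e. x u) + ?t * (\<Prod>u\<in>e'. x u) + ?t\<^sup>2 * (\<Prod>u\<in>sym_diff e e'. x u)) / D)"
  proof (intro integral_cong_AE)
    show "AE x in measure_pmf (ising_pmf d \<theta> E). edge_ratio d \<theta> E e x * edge_ratio d \<theta> E e' x =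
        (1 + ?t * (\<Prod>u\<in>e. x u) + ?t * (\<Prod>u\<in>e'. x u) + ?t\<^sup>2 * (\<Prod>u\<in>sym_diff e e'. x u)) / D"
      unfolding AE_measure_pmf_iff set_ising_pmf
    proof
      fix x assume x: "x \<in> spins d"
      show "edge_ratio d \<theta> E e x * edge_ratio d \<theta> E e' x =
        (1 + ?t * (\<Prod>u\<in>e. x u) + ?t * (\<Prod>u\<in>e'. x u) + ?t\<^sup>2 * (\<Prod>u\<in>sym_diff e e'. x u)) / D"
        unfolding spin_prod_sym_diff[OF x e] edge_ratio_def D_def times_divide_times_eq
        by (simp add: algebra_simps power2_eq_square)
    qed
  qed auto
  also have "\<dots> = (1 + ?t * ?m + ?t * ?m' + ?t\<^sup>2 * ?c) / D"
    by (simp add: spin_corr_def)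
  also have "1 + ?t * ?m + ?t * ?m' + ?t\<^sup>2 * ?c = D + ?t\<^sup>2 * edge_cov d \<theta> E e e'"
    by (simp add: D_def edge_cov_def algebra_simps power2_eq_square)
  also have "(D + ?t\<^sup>2 * edge_cov d \<theta> E e e') / D \<le> (D + ?t\<^sup>2 * \<kappa>) / D"
    using D \<kappa>(2) by (intro divide_right_mono add_left_mono mult_left_mono) auto
  also have "\<dots> = 1 + ?t\<^sup>2 * \<kappa> / D"
    using D by (simp add: add_divide_distrib)
  also have "?t\<^sup>2 * \<kappa> / D \<le> ?t\<^sup>2 * \<kappa> / 1"
    using D \<kappa>(1) by (intro divide_left_mono) auto
  finally show ?thesis
    by simp
qed

lemma pmf_ising_sample_insert:
  assumes "E \<subseteq> nsets {1..d} 2" "e \<subseteq> {1..d}" "e \<notin> E"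
  shows "pmf (ising_sample n d \<theta> (insert e E)) X =
    (\<Prod>i<n. edge_ratio d \<theta> E e (X i)) * pmf (ising_sample n d \<theta> E) X"
  using assms by (auto simp: ising_sample_def pmf_Pi pmf_ising_insert prod.distrib)

lemma finite_set_ising_sample: "finite (set_pmf (ising_sample n d \<theta> E))"
  unfolding ising_sample_def by (subst set_Pi_pmf) (auto intro: finite_PiE_dflt simp: set_ising_pmf)

lemma tanh_le_self:
  fixes x :: real
  assumes "0 \<le> x"
  shows "tanh x \<le> x"
proof (cases "x = 0")
  case False
  have "\<exists>z. 0 < z \<and> z < x \<and> (x - tanh x) - (0 - tanh 0) = (x - 0) * (tanh z)\<^sup>2"
    using False assms by (intro MVT2) (auto intro!: derivative_eq_intros)
  then obtain z where "x - tanh x = x * (tanh z)\<^sup>2"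
    by auto
  moreover have "0 \<le> x * (tanh z)\<^sup>2"
    using assms by simp
  ultimately show ?thesis
    by linarith
qed simp

lemma expectation_sample_ratio_le:
  assumes E: "E \<subseteq> nsets {1..d} 2" and e: "e \<subseteq> {1..d}" "e' \<subseteq> {1..d}"
    and \<theta>: "0 \<le> \<theta>" and \<kappa>: "0 \<le> \<kappa>" "edge_cov d \<theta> E e e' \<le> \<kappa>"
  shows "measure_pmf.expectation (ising_sample n d \<theta> E)
      (\<lambda>X. (\<Prod>i<n. edge_ratio d \<theta> E e (X i)) * (\<Prod>i<n. edge_ratio d \<theta> E e' (X i)))
    \<le> exp (n * \<theta>\<^sup>2 * \<kappa>)"
proof -
  let ?f = "\<lambda>x. edge_ratio d \<theta> E e x * edge_ratio d \<theta> E e' x"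
  have nonneg: "0 \<le> ?f x" if "x \<in> spins d" for x
    using that by (intro mult_nonneg_nonneg edge_ratio_nonneg[OF E _ \<theta>] e)
  have "measure_pmf.expectation (ising_sample n d \<theta> E)
      (\<lambda>X. (\<Prod>i<n. edge_ratio d \<theta> E e (X i)) * (\<Prod>i<n. edge_ratio d \<theta> E e' (X i))) =
      measure_pmf.expectation (ising_sample n d \<theta> E) (\<lambda>X. \<Prod>i<n. ?f (X i))"
    by (simp add: prod.distrib)
  also have "\<dots> = (\<Prod>i<n. measure_pmf.expectation (ising_pmf d \<theta> E) ?f)"
    unfolding ising_sample_def
  proof (rule expectation_prod_Pi_pmf)
    show "integrable (measure_pmf (ising_pmf d \<theta> E)) ?f"
      by (rule integrable_measure_pmf_finite) (simp add: set_ising_pmf)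
  qed (use nonneg in \<open>auto simp: set_ising_pmf\<close>)
  also have "\<dots> = measure_pmf.expectation (ising_pmf d \<theta> E) ?f ^ n"
    by simp
  also have "\<dots> \<le> (1 + (tanh \<theta>)\<^sup>2 * \<kappa>) ^ n"
    using nonneg
    by (intro power_mono expectation_edge_ratio[OF E e \<theta> \<kappa>] integral_nonneg_AE)
      (simp add: AE_measure_pmf_iff set_ising_pmf)
  also have "\<dots> \<le> exp ((tanh \<theta>)\<^sup>2 * \<kappa>) ^ n"
    using \<kappa>(1) by (intro power_mono exp_ge_add_one_self) simp
  also have "\<dots> = exp (n * ((tanh \<theta>)\<^sup>2 * \<kappa>))"
    by (rule exp_of_nat_mult [symmetric])
  also have "\<dots> \<le> exp (n * (\<theta>\<^sup>2 * \<kappa>))"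
    using \<theta> \<kappa>(1) by (intro exp_le_cancel_iff[THEN iffD2] mult_left_mono mult_right_mono power_mono tanh_le_self) auto
  finally show ?thesis
    by (simp add: mult.assoc)
qed

text \<open>
  The diagonal pairs have covariance at most 1 and carry the weight \<open>1 / card S\<close>; the off-diagonal
  pairs are bounded by \<open>\<kappa>\<close>.
\<close>
lemma minimax_risk_ge:
  assumes divider: "null_alternative_divider d P E C" and S: "S \<subseteq> C" "S \<noteq> {}"
    and \<theta>: "0 \<le> \<theta>" and \<kappa>: "0 \<le> \<kappa>"
    and cov: "\<And>e e'. e \<in> S \<Longrightarrow> e' \<in> S \<Longrightarrow> e \<noteq> e' \<Longrightarrow> edge_cov d \<theta> E e e' \<le> \<kappa>"
  shows "ennreal (1 - sqrt (exp (n * \<theta>\<^sup>2) / card S + exp (n * \<theta>\<^sup>2 * \<kappa>) - 1)) \<le> minimax_risk n d P \<theta>"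
proof -
  let ?b = "exp (n * \<theta>\<^sup>2) / card S + exp (n * \<theta>\<^sup>2 * \<kappa>) - 1"
  let ?p = "ising_sample n d \<theta> E" and ?q = "\<lambda>e. ising_sample n d \<theta> (insert e E)"
  let ?L = "\<lambda>e X. \<Prod>i<n. edge_ratio d \<theta> E e (X i)"
  have null: "E \<in> property_class d P False" and C: "C \<subseteq> nsets {1..d} 2"
    and alt: "\<And>e. e \<in> C \<Longrightarrow> insert e E \<in> property_class d P True"
    using divider by (auto simp: null_alternative_divider_def)
  have E: "E \<subseteq> nsets {1..d} 2"
    using null by (auto simp: property_class_def graphs_def)
  have new: "e \<subseteq> {1..d}" "e \<notin> E" if "e \<in> S" for e
  proof -
    show "e \<subseteq> {1..d}"
      using nsets_2_edge(1)[OF C] S that by blast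
    (* An edge of the null base would make one graph have both values of the property. *)
    show "e \<notin> E"
      using alt[of e] null S that by (auto simp: property_class_def insert_absorb)
  qed
  have finS: "finite S"
    using nsets_2_finite[of S d] S C by blast
  have N: "0 < real (card S)"
    using finS S by (simp add: card_gt_0_iff)
  have diag: "edge_cov d \<theta> E e e \<le> 1" for e
    by (simp add: edge_cov_def)
  have "(\<Sum>e\<in>S. \<Sum>e'\<in>S. measure_pmf.expectation ?p (\<lambda>X. ?L e X * ?L e' X)) \<le>
      (\<Sum>e\<in>S. \<Sum>e'\<in>S. (if e = e' then exp (n * \<theta>\<^sup>2) else 0) + exp (n * \<theta>\<^sup>2 * \<kappa>))"
  proof (intro sum_mono)
    fix e e' assume ee: "e \<in> S" "e' \<in> S"
    show "measure_pmf.expectation ?p (\<lambda>X. ?L e X * ?L e' X) \<le>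
        (if e = e' then exp (n * \<theta>\<^sup>2) else 0) + exp (n * \<theta>\<^sup>2 * \<kappa>)"
    proof (cases "e = e'")
      case True
      then show ?thesis
        using expectation_sample_ratio_le[OF E new(1) new(1) \<theta> _ diag, of e n] ee
        by (simp add: add_increasing2)
    next
      case False
      then show ?thesis
        using expectation_sample_ratio_le[OF E new(1) new(1) \<theta> \<kappa> cov[OF ee False], of n] ee by simp
    qed
  qed
  also have "\<dots> = card S * exp (n * \<theta>\<^sup>2) + (card S)\<^sup>2 * exp (n * \<theta>\<^sup>2 * \<kappa>)"
    using finS by (simp add: sum.distrib power2_eq_square algebra_simps)
  also have "\<dots> = (1 + ?b) * (card S)\<^sup>2"
    using N by (simp add: field_simps power2_eq_square)
  finally have moment: "(\<Sum>e\<in>S. \<Sum>e'\<in>S. measure_pmf.expectation ?p (\<lambda>X. ?L e X * ?L e' X)) \<le>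
      (1 + ?b) * (card S)\<^sup>2" .
  show ?thesis
    unfolding minimax_risk_def
  proof (rule INF_greatest)
    fix \<psi> :: "(nat \<Rightarrow> nat \<Rightarrow> real) \<Rightarrow> bool"
    obtain e where e: "e \<in> S" and
      le: "1 - sqrt ?b \<le> measure_pmf.prob ?p {X. \<psi> X} + measure_pmf.prob (?q e) {X. \<not> \<psi> X}"
      using mixture_second_moment_bound[of ?p S ?q ?L, OF finite_set_ising_sample finS S(2) _ moment]
        pmf_ising_sample_insert[OF E new] by blast
    from le have "ennreal (1 - sqrt ?b) \<le>
        emeasure (measure_pmf ?p) {X. \<psi> X} + emeasure (measure_pmf (?q e)) {X. \<not> \<psi> X}"
      by (simp add: measure_pmf.emeasure_eq_measure ennreal_leI flip: ennreal_plus)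
    also have "\<dots> \<le> (SUP G\<in>property_class d P False. emeasure (measure_pmf (ising_sample n d \<theta> G)) {X. \<psi> X}) +
        (SUP G\<in>property_class d P True. emeasure (measure_pmf (ising_sample n d \<theta> G)) {X. \<not> \<psi> X})"
      using null alt e S by (intro add_mono SUP_upper) auto
    finally show "ennreal (1 - sqrt ?b) \<le>
        (SUP G\<in>property_class d P False. emeasure (measure_pmf (ising_sample n d \<theta> G)) {X. \<psi> X}) +
        (SUP G\<in>property_class d P True. emeasure (measure_pmf (ising_sample n d \<theta> G)) {X. \<not> \<psi> X})" .
  qed
qed

lemma minimax_risk_le_1: "minimax_risk n d P \<theta> \<le> 1"
proof -
  have "minimax_risk n d P \<theta> \<le>
      (SUP G\<in>property_class d P False. emeasure (measure_pmf (ising_sample n d \<theta> G)) {X. False}) +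
      (SUP G\<in>property_class d P True. emeasure (measure_pmf (ising_sample n d \<theta> G)) {X. \<not> False})"
    unfolding minimax_risk_def by (rule INF_lower) simp
  also have "\<dots> \<le> 0 + 1"
    by (intro add_mono SUP_least) simp_all
  finally show ?thesis
    by simp
qed

section \<open>Choice of the mixture and conclusion\<close>

lemma packing_number_attained:
  assumes C: "finite C" "C \<noteq> {}"
  obtains S where "is_packing E C r S" "card S = packing_number E C r"
    "1 \<le> packing_number E C r" "packing_number E C r \<le> card C"
proof -
  let ?A = "card ` {S. is_packing E C r S}"
  have "{S. is_packing E C r S} \<subseteq> Pow C"
    by (auto simp: is_packing_def)
  then have fin: "finite ?A"
    using C(1) by (meson finite_Pow_iff finite_imageI finite_subset)
  obtain c where "c \<in> C"
    using C(2) by blast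
  then have single: "is_packing E C r {c}"
    by (simp add: is_packing_def)
  then have "packing_number E C r \<in> ?A"
    unfolding packing_number_def using fin by (intro Max_in) auto
  then obtain S where S: "is_packing E C r S" "card S = packing_number E C r"
    by auto
  have "card {c} \<le> packing_number E C r"
    unfolding packing_number_def using fin single by (intro Max_ge imageI) auto
  moreover have "card S \<le> card C"
    using S(1) C(1) by (intro card_mono) (auto simp: is_packing_def)
  ultimately show ?thesis
    using that S by simp
qed

lemma nat_ceiling_le_enat:
  assumes "ereal r \<le> ereal_of_enat D"
  shows "enat (nat \<lceil>r\<rceil>) \<le> D"
proof (cases D)
  case (enat m)
  then have "r \<le> real m"
    using assms by simp
  then show ?thesis
    by (simp add: enat ceiling_le_iff)
qed simp

lemma tanh_artanh_real:
  fixes a :: real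
  assumes "- 1 < a" "a < 1"
  shows "tanh (artanh a) = a"
proof -
  have pos: "0 < (1 + a) / (1 - a)"
    using assms by simp
  have "- 2 * artanh a = - ln ((1 + a) / (1 - a))"
    by (simp add: artanh_def)
  also have "exp \<dots> = (1 - a) / (1 + a)"
    using pos by (simp add: exp_minus)
  finally have eq: "exp (- 2 * artanh a) = (1 - a) / (1 + a)" .
  show ?thesis
    unfolding tanh_real_altdef eq using assms by (simp add: divide_simps)
qed

lemma exp_minus_4_ln:
  fixes x :: real
  assumes "0 < x"
  shows "exp (- 4 * ln x) = inverse x ^ 4"
proof -
  have "exp (- 4 * ln x) = exp (of_nat 4 * (- ln x))"
    by simp
  also have "\<dots> = exp (- ln x) ^ 4"
    by (rule exp_of_nat_mult)
  finally show ?thesis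
    using assms by (simp add: exp_minus)
qed

text \<open>
  With \<open>n\<close> the sample size and \<open>m\<close> the size of the divider, this adds up the bounds of two regimes,
  so that no case distinction survives in the limit. The terms in \<open>m\<close> alone and in \<open>n\<close> alone outside
  the last exponential bound the diagonal; the last exponential bounds the rest.
\<close>
definition chi_square_bound :: "real \<Rightarrow> real \<Rightarrow> real" where
  "chi_square_bound n m =
     exp (- 3 / 4 * ln m) + exp (- 3 / 4 * ln n) +
     exp (ln n * sqrt (ln n / n) / 2 + inverse (ln m) ^ 3 / 2) - 1"

lemma exp_quarter_ln_divide:
  fixes x :: real
  assumes "0 < x"
  shows "exp (ln x / 4) / x = exp (- 3 / 4 * ln x)"
proof -
  have "exp (ln x / 4) / x = exp (ln x / 4) / exp (ln x)"
    using assms by simp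
  also have "\<dots> = exp (ln x / 4 - ln x)"
    by (rule exp_diff [symmetric])
  finally show ?thesis
    by simp
qed

text \<open>
  Let \<open>N\<close> be the packing number. The hypotheses give \<open>n * \<theta>\<^sup>2 \<le> ln N / 4\<close> and
  \<open>tanh \<theta> * max_degree d E \<le> exp (- 2)\<close>.

  If \<open>N \<le> n\<close>, then \<open>\<theta>\<close> is at most of order \<open>sqrt (ln n / n)\<close> and all covariances of distinct edges are at
  most of that order, so the mixture may run over all of \<open>C\<close>. The diagonal is then small because
  \<open>N powr (1 / 4) / card C \<le> card C powr (- 3 / 4)\<close>, even if \<open>N\<close> stays bounded.

  If \<open>N > n\<close>, the mixture runs over a maximum packing. The diagonal is at most
  \<open>N powr (- 3 / 4)\<close>, and the separation \<open>ln (ln (card C))\<close> makes the covariances at most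
  \<open>2 * ln (card C) powr (- 4)\<close>, which beats the factor \<open>ln N \<le> ln (card C)\<close>.
\<close>
lemma minimax_risk_ge_chi_square_bound:
  assumes divider: "null_alternative_divider d P E C" and \<theta>: "0 \<le> \<theta>"
    and n: "1 \<le> n" and m: "4 \<le> card C"
    and sample: "\<theta> \<le> 1 / 2 * sqrt (ln (packing_number E C (ln (ln (card C)))) / n)"
    and temp: "\<theta> \<le> artanh (exp (- 2) / (real (max_degree d E) + 1))"
  shows "ennreal (1 - sqrt (chi_square_bound n (card C))) \<le> minimax_risk n d P \<theta>"
proof -
  let ?m = "real (card C)"
  define r where "r = ln (ln ?m)"
  define N where "N = packing_number E C r"
  let ?t = "tanh \<theta>" and ?q = "tanh \<theta> * max_degree d E"
  have E: "E \<subseteq> nsets {1..d} 2" and C: "C \<subseteq> nsets {1..d} 2"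
    using divider by (auto simp: null_alternative_divider_def property_class_def graphs_def)
  have finC: "finite C" and C0: "C \<noteq> {}"
    using m by (auto intro: card_ge_0_finite)
  obtain S where S: "is_packing E C r S" "card S = N" and N: "1 \<le> N" "N \<le> card C"
    using packing_number_attained[OF finC C0, of E r] unfolding N_def by blast
  have SC: "S \<subseteq> C" and S0: "S \<noteq> {}"
    using S N by (auto simp: is_packing_def)
  have "exp 1 < ?m"
    using exp_le m by linarith
  then have lnm: "1 < ln ?m"
    using m by (metis exp_gt_zero ln_exp ln_less_cancel_iff order_less_trans)
  have r: "0 < r"
    unfolding r_def using lnm by simp
  have lnN: "0 \<le> ln N" "ln N \<le> ln ?m"
    using N by simp_all
  have t: "0 \<le> ?t" "?t \<le> \<theta>"
    using \<theta> tanh_le_self[OF \<theta>] by simp_all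
  define D where "D = real (max_degree d E)"
  have D: "0 \<le> D"
    by (simp add: D_def)
  have e2: "exp (- 2) < (1 / 2 :: real)"
    using exp_ge_add_one_self[of "2 :: real"] by (simp add: exp_minus field_simps)
  have a: "exp (- 2) / (D + 1) < 1" "0 < exp (- 2) / (D + 1)"
    using D e2 by (simp_all add: divide_less_eq)
  have "?t \<le> tanh (artanh (exp (- 2) / (D + 1)))"
    using temp by (simp add: D_def)
  also have "\<dots> = exp (- 2) / (D + 1)"
    using a by (intro tanh_artanh_real) linarith+
  finally have "?t * (D + 1) \<le> exp (- 2)"
    using D by (simp add: le_divide_eq)
  then have q: "?q \<le> exp (- 2)"
    using t(1) unfolding D_def distrib_left by linarith
  have q0: "0 \<le> ?q"
    using \<theta> by simp
  have "\<theta>\<^sup>2 \<le> (1 / 2 * sqrt (ln N / n))\<^sup>2"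
    using sample \<theta> unfolding N_def r_def by (intro power_mono) simp_all
  also have "\<dots> = ln N / n / 4"
    using lnN(1) n by (simp add: power_mult_distrib power2_eq_square)
  finally have n\<theta>: "n * \<theta>\<^sup>2 \<le> ln N / 4"
    using n by (simp add: field_simps)
  (* What a mixture set A with covariance bound \<kappa> has to satisfy; both regimes instantiate this. *)
  have risk: "ennreal (1 - sqrt (chi_square_bound n ?m)) \<le> minimax_risk n d P \<theta>"
    if A: "A \<subseteq> C" "A \<noteq> {}" and \<kappa>: "0 \<le> \<kappa>"
      and cov: "\<And>e e'. e \<in> A \<Longrightarrow> e' \<in> A \<Longrightarrow> e \<noteq> e' \<Longrightarrow> edge_cov d \<theta> E e e' \<le> \<kappa>"
      and diag_le: "exp (ln N / 4) / card A \<le> exp (- 3 / 4 * ln ?m) + exp (- 3 / 4 * ln n)"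
      and off_diag_le: "ln N / 4 * \<kappa> \<le> ln n * sqrt (ln n / n) / 2 + inverse (ln ?m) ^ 3 / 2"
    for A \<kappa>
  proof -
    have "exp (n * \<theta>\<^sup>2) / card A \<le> exp (ln N / 4) / card A"
      using n\<theta> by (intro divide_right_mono) simp_all
    moreover have "exp (n * \<theta>\<^sup>2 * \<kappa>) \<le> exp (ln N / 4 * \<kappa>)"
      using n\<theta> \<kappa> by (intro exp_le_cancel_iff[THEN iffD2] mult_right_mono)
    moreover have "exp (ln N / 4 * \<kappa>) \<le> exp (ln n * sqrt (ln n / n) / 2 + inverse (ln ?m) ^ 3 / 2)"
      using off_diag_le by (rule exp_le_cancel_iff[THEN iffD2])
    ultimately have "exp (n * \<theta>\<^sup>2) / card A + exp (n * \<theta>\<^sup>2 * \<kappa>) - 1 \<le> chi_square_bound n ?m"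
      unfolding chi_square_bound_def using diag_le by linarith
    then have "ennreal (1 - sqrt (chi_square_bound n ?m)) \<le>
        ennreal (1 - sqrt (exp (n * \<theta>\<^sup>2) / card A + exp (n * \<theta>\<^sup>2 * \<kappa>) - 1))"
      by (intro ennreal_leI diff_left_mono real_sqrt_le_mono)
    also have "\<dots> \<le> minimax_risk n d P \<theta>"
      by (rule minimax_risk_ge[OF divider A \<theta> \<kappa> cov])
    finally show ?thesis .
  qed
  show ?thesis
  proof (cases "N \<le> n")
    case True
    have lnNn: "ln N \<le> ln n"
      using N True by simp
    have "?t \<le> 1 / 2 * sqrt (ln N / n)"
      using t(2) sample unfolding N_def r_def by (rule order_trans)
    also have "\<dots> \<le> 1 / 2 * sqrt (ln n / n)"
      using lnNn n by (intro mult_left_mono real_sqrt_le_mono divide_right_mono) simp_all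
    finally have t_le: "?t \<le> 1 / 2 * sqrt (ln n / n)" .
    show ?thesis
    proof (rule risk[of C "4 * ?t"])
      fix e e' assume "e \<in> C" "e' \<in> C" "e \<noteq> e'"
      then show "edge_cov d \<theta> E e e' \<le> 4 * ?t"
        using C q e2 by (intro edge_cov_le_distinct[OF E \<theta>]) auto
    next
      have "exp (ln N / 4) / ?m \<le> exp (ln ?m / 4) / ?m"
        using lnN by (intro divide_right_mono) simp_all
      also have "\<dots> = exp (- 3 / 4 * ln ?m)"
        using m by (intro exp_quarter_ln_divide) simp
      finally show "exp (ln N / 4) / ?m \<le> exp (- 3 / 4 * ln ?m) + exp (- 3 / 4 * ln n)"
        by (simp add: add_increasing2)
    next
      have "ln N / 4 * (4 * ?t) = ln N * ?t"
        by simp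
      also have "\<dots> \<le> ln n * (1 / 2 * sqrt (ln n / n))"
        using lnN lnNn t t_le by (intro mult_mono) simp_all
      finally show "ln N / 4 * (4 * ?t) \<le> ln n * sqrt (ln n / n) / 2 + inverse (ln ?m) ^ 3 / 2"
        using lnm by (simp add: add_increasing2)
    qed (use C0 t in simp_all)
  next
    case False
    define k where "k = nat \<lceil>r\<rceil>"
    have k: "0 < k" "r \<le> real k"
      using r by (simp_all add: k_def)
    have "?q ^ (2 * k) \<le> exp (- 2) ^ (2 * k)"
      using q q0 by (rule power_mono)
    also have "\<dots> = exp (- 4 * real k)"
      by (simp flip: exp_of_nat_mult)
    also have "\<dots> \<le> exp (- 4 * ln (ln ?m))"
      using k(2) by (simp add: r_def)
    also have "\<dots> = inverse (ln ?m) ^ 4"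
      using lnm by (intro exp_minus_4_ln) simp
    finally have decay: "?q ^ (2 * k) \<le> inverse (ln ?m) ^ 4" .
    show ?thesis
    proof (rule risk[OF SC S0, of "2 * inverse (ln ?m) ^ 4"])
      fix e e' assume e: "e \<in> S" "e' \<in> S" "e \<noteq> e'"
      then have "enat k \<le> edge_dist E e e'"
        using S(1) unfolding k_def is_packing_def by (intro nat_ceiling_le_enat) blast
      then have "edge_cov d \<theta> E e e' \<le> 2 * ?q ^ (2 * k)"
        using e SC C k(1) by (intro edge_cov_le_far[OF E \<theta>]) auto
      then show "edge_cov d \<theta> E e e' \<le> 2 * inverse (ln ?m) ^ 4"
        using decay by linarith
    next
      have "exp (ln N / 4) / N = exp (- 3 / 4 * ln N)"
        using N by (intro exp_quarter_ln_divide) simp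
      also have "\<dots> \<le> exp (- 3 / 4 * ln n)"
        using False n by simp
      finally show "exp (ln N / 4) / card S \<le> exp (- 3 / 4 * ln ?m) + exp (- 3 / 4 * ln n)"
        unfolding S(2) by (simp add: add_increasing)
    next
      have "ln N / 4 * (2 * inverse (ln ?m) ^ 4) \<le> ln ?m / 4 * (2 * inverse (ln ?m) ^ 4)"
        using lnN lnm by (intro mult_right_mono divide_right_mono) simp_all
      also have "\<dots> = inverse (ln ?m) ^ 3 / 2"
        using lnm by (simp add: power_eq_if field_simps)
      finally show "ln N / 4 * (2 * inverse (ln ?m) ^ 4) \<le> ln n * sqrt (ln n / n) / 2 + inverse (ln ?m) ^ 3 / 2"
        using n by (simp add: add_increasing)
    qed (use lnm in simp)
  qed
qed

lemma chi_square_bound_tendsto_0: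
  fixes m :: "nat \<Rightarrow> nat"
  assumes m: "filterlim m at_top sequentially"
  shows "(\<lambda>n. chi_square_bound (real n) (real (m n))) \<longlonglongrightarrow> 0"
proof -
  have m': "filterlim (\<lambda>n. real (m n)) at_top sequentially"
    using m filterlim_real_sequentially by (rule filterlim_compose[rotated])
  have "((\<lambda>x :: real. exp (- 3 / 4 * ln x)) \<longlongrightarrow> 0) at_top"
    by real_asymp
  moreover have "((\<lambda>x :: real. inverse (ln x) ^ 3 / 2) \<longlongrightarrow> 0) at_top"
    by real_asymp
  ultimately have m_lim: "(\<lambda>n. exp (- 3 / 4 * ln (real (m n)))) \<longlonglongrightarrow> 0"
    "(\<lambda>n. inverse (ln (real (m n))) ^ 3 / 2) \<longlonglongrightarrow> 0"
    using filterlim_compose[OF _ m'] by blast+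
  have n_lim: "(\<lambda>n. exp (- 3 / 4 * ln (real n))) \<longlonglongrightarrow> 0"
    "(\<lambda>n. ln (real n) * sqrt (ln (real n) / real n) / 2) \<longlonglongrightarrow> 0"
    by real_asymp+
  have "(\<lambda>n. chi_square_bound (real n) (real (m n))) \<longlonglongrightarrow> 0 + 0 + exp (0 + 0) - 1"
    unfolding chi_square_bound_def by (intro tendsto_intros m_lim n_lim)
  then show ?thesis
    by simp
qed

theorem theorem2p4:
  fixes d :: "nat \<Rightarrow> nat"
    and P :: "nat \<Rightarrow> nat set set \<Rightarrow> bool"
    and E0 C :: "nat \<Rightarrow> nat set set"
    and \<theta> :: "nat \<Rightarrow> real"
  assumes d_lim: "filterlim d at_top sequentially"
    and null_base: "\<And>n. E0 n \<in> property_class (d n) (P n) False"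
    and divider: "\<And>n. null_alternative_divider (d n) (P n) (E0 n) (C n)"
    and card_lim: "filterlim (\<lambda>n. card (C n)) at_top sequentially"
    and theta_nonneg: "\<And>n. \<theta> n \<ge> 0"
    and theta_bound: "eventually (\<lambda>n. \<theta> n \<le>
          min (1 / 2 * sqrt (ln (real (packing_number (E0 n) (C n) (ln (ln (real (card (C n))))))) / real n))
              (artanh (exp (- 2) / (real (max_degree (d n) (E0 n)) + 1)))) sequentially"
  shows "liminf (\<lambda>n. minimax_risk n (d n) (P n) (\<theta> n)) = 1"
proof -
  let ?l = "\<lambda>n. ennreal (1 - sqrt (chi_square_bound (real n) (real (card (C n)))))"
  have lower: "eventually (\<lambda>n. ?l n \<le> minimax_risk n (d n) (P n) (\<theta> n)) sequentially"
    using theta_bound eventually_ge_at_top[of 1] filterlim_at_top[THEN iffD1, OF card_lim, rule_format, of 4]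
  proof eventually_elim
    case (elim n)
    then show ?case
      using divider theta_nonneg by (intro minimax_risk_ge_chi_square_bound) auto
  qed
  have upper: "eventually (\<lambda>n. minimax_risk n (d n) (P n) (\<theta> n) \<le> 1) sequentially"
    by (simp add: minimax_risk_le_1)
  have "?l \<longlonglongrightarrow> ennreal (1 - sqrt 0)"
    by (rule tendsto_ennrealI[OF tendsto_diff[OF tendsto_const
      tendsto_real_sqrt[OF chi_square_bound_tendsto_0[OF card_lim]]]])
  then have lim: "?l \<longlonglongrightarrow> 1"
    by simp
  have "(\<lambda>n. minimax_risk n (d n) (P n) (\<theta> n)) \<longlonglongrightarrow> 1"
    by (rule tendsto_sandwich[OF lower upper lim tendsto_const])
  then show ?thesis
    by (rule lim_imp_Liminf[OF trivial_limit_sequentially])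
qed

end
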